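(* Let $a\in\mathbb{Q}_2$ with $|a|_2>1$ and let $\phi(x)=ax+\frac1x$, viewed as a continuous map $\phi:\mathbb{P}^1(\mathbb{Q}_2)\to\mathbb{P}^1(\mathbb{Q}_2)$. Let $\mathcal{F}_\phi$ and $\mathcal{J}_\phi$ denote its Fatou and Julia sets. (i) If $\sqrt{1-a}\notin\mathbb{Q}_2$ (i.e. $1-a$ is not a square in $\mathbb{Q}_2$), then $\mathcal{F}_\phi=\mathbb{P}^1(\mathbb{Q}_2)$. Moreover, for all $x\in\mathbb{Q}_2$, $\lim_{n\to\infty}\phi^n(x)=\infty$. (ii) If $\sqrt{1-a}\in\mathbb{Q}_2$ (i.e. $1-a$ is a square in $\mathbb{Q}_2$), then $$\mathcal{J}_\phi=\left\{x\in\mathbb{Q}_2: |\phi^n(x)|_2=\frac{1}{\sqrt{|a|_2}}\ \text{ for all } n\ge 0\right\},$$ and $(\mathcal{J}_\phi,\phi)$ is topologically conjugate to the full shift $(\Sigma_2,\sigma)$ on two symbols. Moreover, for all $x\in\mathcal{F}_\phi$, $\lim_{n\to\infty}\phi^n(x)=\infty$.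
   Context: $\mathbb{Q}_2$ is the field of 2-adic numbers with absolute value $|\cdot|_2$ ($|2|_2=1/2$). $\mathbb{P}^1(\mathbb{Q}_2)=\mathbb{Q}_2\cup\{\infty\}$ carries the spherical metric $\rho(z_1,z_2)=\frac{|z_1-z_2|_2}{\max\{|z_1|_2,1\}\max\{|z_2|_2,1\}}$ for $z_1,z_2\in\mathbb{Q}_2$, and $\rho(z,\infty)=1$ if $|z|_2\le1$, $\rho(z,\infty)=1/|z|_2$ if $|z|_2>1$. Here $\phi(0)=\phi(\infty)=\infty$, $\phi^n$ denotes the $n$-th iterate, and limits are taken in $\rho$. For a continuous self-map $\phi$ of a metric space $X$, the Fatou set $\mathcal{F}_\phi$ is the set of points $z\in X$ having a neighborhood on which the family $\{\phi^n\}_{n\ge1}$ is equicontinuous; the Julia set is $\mathcal{J}_\phi=X\setminus\mathcal{F}_\phi$. $\Sigma_2=\{0,1\}^{\mathbb{N}}$ with the product topology and $\sigma$ is the left shift, $(\sigma(x))_i=x_{i+1}$. Two systems $(Y,f)$, $(Z,g)$ are topologically conjugate if there is a homeomorphism $h:Y\to Z$ with $h\circ f=g\circ h$. *)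

theory Defs
  imports "HOL-Analysis.Analysis" "HOL-Computational_Algebra.Primes"
begin

section \<open>The 2-adic absolute value on the rationals\<close>

definition rat_abs2 :: "rat \<Rightarrow> real" where
  "rat_abs2 r =
     (if r = 0 then 0
      else 2 powi (int (multiplicity 2 (snd (quotient_of r)))
                   - int (multiplicity 2 (fst (quotient_of r)))))"

lemma rat_abs2_0 [simp]: "rat_abs2 0 = 0"
  by (simp add: rat_abs2_def)

lemma mult2_mult:
  "a \<noteq> 0 \<Longrightarrow> b \<noteq> 0 \<Longrightarrow> multiplicity 2 (a * b :: int) = multiplicity 2 a + multiplicity 2 b"
  by (rule prime_elem_multiplicity_mult_distrib) auto

lemma rat_abs2_divide:
  assumes "a \<noteq> 0" "b \<noteq> 0"
  shows "rat_abs2 (of_int a / of_int b) = 2 powi (int (multiplicity 2 b) - int (multiplicity 2 a))"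
proof -
  define r :: rat where "r = of_int a / of_int b"
  obtain c d where q: "quotient_of r = (c, d)" by fastforce
  then have d: "d > 0" and r: "r = of_int c / of_int d"
    by (auto simp: quotient_of_denom_pos quotient_of_div)
  have r0: "r \<noteq> 0" using assms by (simp add: r_def)
  then have c: "c \<noteq> 0" using r by auto
  have "of_int a * (of_int d :: rat) = of_int c * of_int b"
    using r assms d by (simp add: r_def field_simps)
  then have "a * d = c * b"
    by (metis of_int_eq_iff of_int_mult)
  then have "multiplicity 2 a + multiplicity 2 d = multiplicity 2 c + multiplicity 2 b"
    by (metis mult2_mult assms c d less_irrefl)
  then have "int (multiplicity 2 b) - int (multiplicity 2 a) =
      int (multiplicity 2 d) - int (multiplicity 2 c)" by linarith
  then show ?thesis using q r0 by (simp add: rat_abs2_def flip: r_def)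
qed

lemma rat_cases_int:
  obtains a b where "(r::rat) = of_int a / of_int b" "b \<noteq> 0"
proof (cases "quotient_of r")
  case (Pair a b)
  then show ?thesis
    using that[of a b] quotient_of_div[OF Pair] quotient_of_denom_pos[OF Pair] by simp
qed

lemma rat_abs2_1 [simp]: "rat_abs2 1 = 1"
  using rat_abs2_divide[of 1 1] by simp

lemma rat_abs2_2: "rat_abs2 2 = 1 / 2"
  using rat_abs2_divide[of 2 1] by (simp add: power_int_minus)

lemma rat_abs2_nonneg [simp]: "rat_abs2 r \<ge> 0"
  by (simp add: rat_abs2_def)

lemma rat_abs2_eq_0_iff [simp]: "rat_abs2 r = 0 \<longleftrightarrow> r = 0"
  by (simp add: rat_abs2_def)

lemma rat_abs2_mult: "rat_abs2 (r * s) = rat_abs2 r * rat_abs2 s"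
proof (cases "r = 0 \<or> s = 0")
  case False
  obtain a b where r: "r = of_int a / of_int b" "b \<noteq> 0" by (rule rat_cases_int)
  obtain c d where s: "s = of_int c / of_int d" "d \<noteq> 0" by (rule rat_cases_int)
  have ac: "a \<noteq> 0" "c \<noteq> 0" using False r s by auto
  have rs: "r * s = of_int (a * c) / of_int (b * d)" by (simp add: r s)
  have "rat_abs2 (r * s) = 2 powi (int (multiplicity 2 (b * d)) - int (multiplicity 2 (a * c)))"
    unfolding rs using ac r s by (intro rat_abs2_divide) auto
  also have "\<dots> = 2 powi ((int (multiplicity 2 b) - int (multiplicity 2 a))
                         + (int (multiplicity 2 d) - int (multiplicity 2 c)))"
    using ac r s by (simp add: mult2_mult algebra_simps)
  also have "\<dots> = rat_abs2 r * rat_abs2 s"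
    using ac r s by (simp add: power_int_add rat_abs2_divide)
  finally show ?thesis .
qed auto

lemma rat_abs2_minus [simp]: "rat_abs2 (- r) = rat_abs2 r"
proof -
  have "rat_abs2 (-1) * rat_abs2 (-1) = 1"
    by (simp flip: rat_abs2_mult)
  then have "rat_abs2 (-1) = 1"
    using rat_abs2_nonneg[of "-1"] by (metis abs_of_nonneg abs_1 real_sqrt_abs2 real_sqrt_one)
  then show ?thesis using rat_abs2_mult[of "-1" r] by simp
qed

lemma rat_abs2_diff_commute: "rat_abs2 (r - s) = rat_abs2 (s - r)"
  using rat_abs2_minus[of "r - s"] by simp

lemma rat_abs2_inverse: "rat_abs2 (inverse r) = inverse (rat_abs2 r)"
proof (cases "r = 0")
  case False
  then have "rat_abs2 r * rat_abs2 (inverse r) = 1"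
    by (simp flip: rat_abs2_mult)
  then show ?thesis by (simp add: inverse_unique)
qed auto

lemma rat_abs2_add: "rat_abs2 (r + s) \<le> max (rat_abs2 r) (rat_abs2 s)"
proof (cases "r = 0 \<or> s = 0 \<or> r + s = 0")
  case True
  then show ?thesis
  proof (elim disjE)
    assume "r + s = 0"
    then show ?thesis by (simp add: le_max_iff_disj)
  qed auto
next
  case False
  obtain a b where r: "r = of_int a / of_int b" "b \<noteq> 0" by (rule rat_cases_int)
  obtain c d where s: "s = of_int c / of_int d" "d \<noteq> 0" by (rule rat_cases_int)
  have r': "r = of_int (a * d) / of_int (b * d)" using r s by simp
  have s': "s = of_int (b * c) / of_int (b * d)" using r s by simp
  have rs: "r + s = of_int (a * d + b * c) / of_int (b * d)"
    using r s by (simp add: field_simps)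
  have nz: "a * d \<noteq> 0" "b * c \<noteq> 0" "b * d \<noteq> 0" using False r s by auto
  have nz': "a * d + b * c \<noteq> 0" using False rs by (metis div_0 of_int_0)
  let ?m = "min (multiplicity 2 (a * d)) (multiplicity 2 (b * c))"
  have "2 ^ ?m dvd a * d + b * c"
    by (intro dvd_add multiplicity_dvd') auto
  then have m: "?m \<le> multiplicity 2 (a * d + b * c)"
    by (intro multiplicity_geI) (use nz' in auto)
  have "rat_abs2 (r + s) =
      2 powi (int (multiplicity 2 (b * d)) - int (multiplicity 2 (a * d + b * c)))"
    unfolding rs using nz nz' by (intro rat_abs2_divide)
  also have "\<dots> \<le> 2 powi (int (multiplicity 2 (b * d)) - int ?m)"
    using m by (intro power_int_increasing) auto
  also have "\<dots> \<le> max (2 powi (int (multiplicity 2 (b * d)) - int (multiplicity 2 (a * d))))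
                    (2 powi (int (multiplicity 2 (b * d)) - int (multiplicity 2 (b * c))))"
    by (auto simp: min_def)
  also have "\<dots> = max (rat_abs2 r) (rat_abs2 s)"
    unfolding r' s' using nz by (metis rat_abs2_divide)
  finally show ?thesis .
qed

lemma rat_abs2_diff: "rat_abs2 (r - s) \<le> max (rat_abs2 r) (rat_abs2 s)"
  using rat_abs2_add[of r "- s"] by simp

lemma rat_abs2_diff_trans:
  "rat_abs2 (r - t) \<le> max (rat_abs2 (r - s)) (rat_abs2 (s - t))"
  using rat_abs2_add[of "r - s" "s - t"] by simp

lemma rat_abs2_eq_of_close:
  assumes "rat_abs2 (r - s) < rat_abs2 s"
  shows "rat_abs2 r = rat_abs2 s"
  using rat_abs2_add[of "r - s" s] rat_abs2_diff[of r "r - s"] assms by simp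


section \<open>The field of 2-adic numbers as the completion of the rationals\<close>

definition cauchy2 :: "(nat \<Rightarrow> rat) \<Rightarrow> bool" where
  "cauchy2 X \<longleftrightarrow> (\<forall>e>0. \<exists>M. \<forall>m\<ge>M. \<forall>n\<ge>M. rat_abs2 (X m - X n) < e)"

definition vanishes2 :: "(nat \<Rightarrow> rat) \<Rightarrow> bool" where
  "vanishes2 X \<longleftrightarrow> (\<forall>e>0. \<exists>M. \<forall>n\<ge>M. rat_abs2 (X n) < e)"

lemma vanishes2_iff_tendsto: "vanishes2 X \<longleftrightarrow> (\<lambda>n. rat_abs2 (X n)) \<longlonglongrightarrow> 0"
  by (simp add: vanishes2_def LIMSEQ_iff)

lemma cauchy2_const [simp]: "cauchy2 (\<lambda>_. r)"
  by (simp add: cauchy2_def)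

lemma vanishes2_const [simp]: "vanishes2 (\<lambda>_. r) \<longleftrightarrow> r = 0"
  by (auto simp: vanishes2_iff_tendsto tendsto_const_iff LIMSEQ_const_iff)

lemma vanishes2_minus [simp]: "vanishes2 (\<lambda>n. - X n) \<longleftrightarrow> vanishes2 X"
  by (simp add: vanishes2_def)

lemma vanishes2_add:
  assumes "vanishes2 X" "vanishes2 Y"
  shows "vanishes2 (\<lambda>n. X n + Y n)"
  unfolding vanishes2_def
proof (intro allI impI)
  fix e :: real assume "e > 0"
  then obtain M N where "\<forall>n\<ge>M. rat_abs2 (X n) < e" "\<forall>n\<ge>N. rat_abs2 (Y n) < e"
    using assms unfolding vanishes2_def by metis
  then have "\<forall>n\<ge>max M N. rat_abs2 (X n + Y n) < e"
    by (auto intro!: le_less_trans[OF rat_abs2_add])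
  then show "\<exists>M. \<forall>n\<ge>M. rat_abs2 (X n + Y n) < e" by blast
qed

lemma vanishes2_diff:
  assumes "vanishes2 X" "vanishes2 Y"
  shows "vanishes2 (\<lambda>n. X n - Y n)"
  using vanishes2_add[of X "\<lambda>n. - Y n"] assms by simp

lemma cauchy2_eventually_const:
  assumes "cauchy2 X" "\<not> vanishes2 X"
  obtains c M where "c > 0" "\<And>n. n \<ge> M \<Longrightarrow> rat_abs2 (X n) = c"
proof -
  from assms(2) obtain e where e: "e > 0" "\<forall>M. \<exists>n\<ge>M. rat_abs2 (X n) \<ge> e"
    unfolding vanishes2_def by (meson not_le)
  from assms(1) e obtain M where M: "\<forall>m\<ge>M. \<forall>n\<ge>M. rat_abs2 (X m - X n) < e"
    unfolding cauchy2_def by blast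
  from e obtain n where n: "n \<ge> M" "rat_abs2 (X n) \<ge> e" by blast
  show ?thesis
  proof (rule that)
    show "rat_abs2 (X n) > 0" using n e by simp
    show "rat_abs2 (X m) = rat_abs2 (X n)" if "m \<ge> M" for m
      using M that n by (intro rat_abs2_eq_of_close) (meson less_le_trans)
  qed
qed

lemma cauchy2_bounded:
  assumes "cauchy2 X"
  obtains B M where "B > 0" "\<And>n. n \<ge> M \<Longrightarrow> rat_abs2 (X n) \<le> B"
proof (cases "vanishes2 X")
  case True
  then obtain M where "\<forall>n\<ge>M. rat_abs2 (X n) < 1"
    unfolding vanishes2_def by (meson zero_less_one)
  then show ?thesis using that[of 1 M] less_imp_le zero_less_one by blast
next
  case False
  then show ?thesis using cauchy2_eventually_const[OF assms] that by (metis order_refl)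
qed

lemma cauchy2_add:
  assumes "cauchy2 X" "cauchy2 Y"
  shows "cauchy2 (\<lambda>n. X n + Y n)"
  unfolding cauchy2_def
proof (intro allI impI)
  fix e :: real assume "e > 0"
  then obtain M N where MN: "\<forall>m\<ge>M. \<forall>n\<ge>M. rat_abs2 (X m - X n) < e"
      "\<forall>m\<ge>N. \<forall>n\<ge>N. rat_abs2 (Y m - Y n) < e"
    using assms unfolding cauchy2_def by metis
  have "rat_abs2 (X m + Y m - (X n + Y n)) < e" if "m \<ge> max M N" "n \<ge> max M N" for m n
    using rat_abs2_add[of "X m - X n" "Y m - Y n"] MN that
    by (auto simp: add_diff_add intro: le_less_trans)
  then show "\<exists>M. \<forall>m\<ge>M. \<forall>n\<ge>M. rat_abs2 (X m + Y m - (X n + Y n)) < e" by blast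
qed

lemma cauchy2_minus [simp]: "cauchy2 X \<Longrightarrow> cauchy2 (\<lambda>n. - X n)"
  by (simp add: cauchy2_def rat_abs2_diff_commute)

lemma cauchy2_diff: "cauchy2 X \<Longrightarrow> cauchy2 Y \<Longrightarrow> cauchy2 (\<lambda>n. X n - Y n)"
  using cauchy2_add[of X "\<lambda>n. - Y n"] by simp

lemma vanishes2_mult_bounded:
  assumes "cauchy2 X" "vanishes2 Y"
  shows "vanishes2 (\<lambda>n. X n * Y n)"
  unfolding vanishes2_def
proof (intro allI impI)
  fix e :: real assume "e > 0"
  obtain B M where B: "B > 0" "\<And>n. n \<ge> M \<Longrightarrow> rat_abs2 (X n) \<le> B"
    using cauchy2_bounded[OF assms(1)] by blast
  obtain N where N: "\<forall>n\<ge>N. rat_abs2 (Y n) < e / B"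
    using assms(2) B \<open>e > 0\<close> unfolding vanishes2_def by (meson divide_pos_pos)
  have "rat_abs2 (X n * Y n) < e" if "n \<ge> max M N" for n
  proof -
    have "rat_abs2 (X n * Y n) \<le> B * rat_abs2 (Y n)"
      using B that by (simp add: rat_abs2_mult mult_right_mono)
    also have "\<dots> < B * (e / B)" using N B that by (intro mult_strict_left_mono) auto
    finally show ?thesis using B by simp
  qed
  then show "\<exists>M. \<forall>n\<ge>M. rat_abs2 (X n * Y n) < e" by blast
qed

lemma cauchy2_mult:
  assumes "cauchy2 X" "cauchy2 Y"
  shows "cauchy2 (\<lambda>n. X n * Y n)"
  unfolding cauchy2_def
proof (intro allI impI)
  fix e :: real assume "e > 0"
  obtain B M where B: "B > 0" "\<And>n. n \<ge> M \<Longrightarrow> rat_abs2 (X n) \<le> B"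
    using cauchy2_bounded[OF assms(1)] by blast
  obtain C N where C: "C > 0" "\<And>n. n \<ge> N \<Longrightarrow> rat_abs2 (Y n) \<le> C"
    using cauchy2_bounded[OF assms(2)] by blast
  obtain K where K: "\<forall>m\<ge>K. \<forall>n\<ge>K. rat_abs2 (X m - X n) < e / C"
    using assms C \<open>e > 0\<close> unfolding cauchy2_def by (meson divide_pos_pos)
  obtain L where L: "\<forall>m\<ge>L. \<forall>n\<ge>L. rat_abs2 (Y m - Y n) < e / B"
    using assms B \<open>e > 0\<close> unfolding cauchy2_def by (meson divide_pos_pos)
  have "rat_abs2 (X m * Y m - X n * Y n) < e"
    if "m \<ge> Max {M, N, K, L}" "n \<ge> Max {M, N, K, L}" for m n
  proof -
    have "X m * Y m - X n * Y n = X m * (Y m - Y n) + (X m - X n) * Y n"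
      by (simp add: algebra_simps)
    then have "rat_abs2 (X m * Y m - X n * Y n) \<le>
        max (rat_abs2 (X m) * rat_abs2 (Y m - Y n)) (rat_abs2 (X m - X n) * rat_abs2 (Y n))"
      by (metis rat_abs2_add rat_abs2_mult)
    moreover have "rat_abs2 (X m) * rat_abs2 (Y m - Y n) < e"
    proof -
      have "rat_abs2 (X m) * rat_abs2 (Y m - Y n) \<le> B * rat_abs2 (Y m - Y n)"
        using B that by (intro mult_right_mono) auto
      also have "\<dots> < B * (e / B)" using L B that by (intro mult_strict_left_mono) auto
      finally show ?thesis using B by simp
    qed
    moreover have "rat_abs2 (X m - X n) * rat_abs2 (Y n) < e"
    proof -
      have "rat_abs2 (X m - X n) * rat_abs2 (Y n) \<le> rat_abs2 (X m - X n) * C"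
        using C that by (intro mult_left_mono) auto
      also have "\<dots> < e / C * C" using K C that by (intro mult_strict_right_mono) auto
      finally show ?thesis using C by simp
    qed
    ultimately show ?thesis by simp
  qed
  then show "\<exists>M. \<forall>m\<ge>M. \<forall>n\<ge>M. rat_abs2 (X m * Y m - X n * Y n) < e" by blast
qed

lemma cauchy2_inverse:
  assumes "cauchy2 X" "\<not> vanishes2 X"
  shows "cauchy2 (\<lambda>n. inverse (X n))"
  unfolding cauchy2_def
proof (intro allI impI)
  fix e :: real assume "e > 0"
  obtain c M where c: "c > 0" "\<And>n. n \<ge> M \<Longrightarrow> rat_abs2 (X n) = c"
    using cauchy2_eventually_const[OF assms] by blast
  obtain N where N: "\<forall>m\<ge>N. \<forall>n\<ge>N. rat_abs2 (X m - X n) < e * (c * c)"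
    using assms(1) \<open>e > 0\<close> c unfolding cauchy2_def by (meson mult_pos_pos)
  have "rat_abs2 (inverse (X m) - inverse (X n)) < e" if "m \<ge> max M N" "n \<ge> max M N" for m n
  proof -
    have nz: "X m \<noteq> 0" "X n \<noteq> 0" using c that by (metis max.boundedE rat_abs2_0 less_irrefl)+
    have "inverse (X m) - inverse (X n) = (X n - X m) * inverse (X m) * inverse (X n)"
      using nz by (simp add: field_simps)
    then have "rat_abs2 (inverse (X m) - inverse (X n)) = rat_abs2 (X n - X m) / (c * c)"
      using c that by (simp add: rat_abs2_mult rat_abs2_inverse divide_inverse)
    also have "\<dots> < e" using N c that by (simp add: divide_less_eq)
    finally show ?thesis .
  qed
  then show "\<exists>M. \<forall>m\<ge>M. \<forall>n\<ge>M. rat_abs2 (inverse (X m) - inverse (X n)) < e" by blast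
qed

lemma vanishes2_inverse_mult:
  assumes "cauchy2 X" "\<not> vanishes2 X"
  shows "vanishes2 (\<lambda>n. inverse (X n) * X n - 1)"
proof -
  obtain c M where c: "c > 0" "\<And>n. n \<ge> M \<Longrightarrow> rat_abs2 (X n) = c"
    using cauchy2_eventually_const[OF assms] by blast
  have "inverse (X n) * X n - 1 = 0" if "n \<ge> M" for n
    using c that by (metis eq_iff_diff_eq_0 left_inverse rat_abs2_0 less_irrefl)
  then show ?thesis unfolding vanishes2_def by (metis rat_abs2_0)
qed

lemma vanishes2_diff_inverse:
  assumes X: "cauchy2 X" "\<not> vanishes2 X" and Y: "cauchy2 Y" "\<not> vanishes2 Y"
    and XY: "vanishes2 (\<lambda>n. X n - Y n)"
  shows "vanishes2 (\<lambda>n. inverse (X n) - inverse (Y n))"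
proof -
  let ?X = "\<lambda>n. inverse (X n)" and ?Y = "\<lambda>n. inverse (Y n)"
  have "vanishes2 (\<lambda>n. (?X n * ?Y n) * (X n - Y n))"
    by (intro vanishes2_mult_bounded cauchy2_mult cauchy2_inverse X Y XY)
  moreover have "vanishes2 (\<lambda>n. ?Y n * (?X n * X n - 1))"
    by (intro vanishes2_mult_bounded cauchy2_inverse vanishes2_inverse_mult X Y)
  moreover have "vanishes2 (\<lambda>n. ?X n * (?Y n * Y n - 1))"
    by (intro vanishes2_mult_bounded cauchy2_inverse vanishes2_inverse_mult X Y)
  ultimately have "vanishes2 (\<lambda>n. ?Y n * (?X n * X n - 1) - ?X n * (?Y n * Y n - 1)
      - (?X n * ?Y n) * (X n - Y n))"
    by (intro vanishes2_diff)
  then show ?thesis by (simp add: algebra_simps)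
qed

definition q2rel :: "(nat \<Rightarrow> rat) \<Rightarrow> (nat \<Rightarrow> rat) \<Rightarrow> bool" where
  "q2rel X Y \<longleftrightarrow> cauchy2 X \<and> cauchy2 Y \<and> vanishes2 (\<lambda>n. X n - Y n)"

lemma q2rel_refl: "cauchy2 X \<Longrightarrow> q2rel X X"
  by (simp add: q2rel_def)

lemma part_equivp_q2rel: "part_equivp q2rel"
proof (rule part_equivpI)
  show "\<exists>X. q2rel X X" using q2rel_refl cauchy2_const by blast
  show "symp q2rel"
    by (auto simp: symp_def q2rel_def vanishes2_def rat_abs2_diff_commute)
  show "transp q2rel"
    unfolding transp_def q2rel_def by (force dest: vanishes2_add)
qed

quotient_type q2 = "nat \<Rightarrow> rat" / partial: q2rel
  morphisms rep_q2 abs_q2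
  by (rule part_equivp_q2rel)

lemma cr_q2_eq: "pcr_q2 = (\<lambda>X y. cauchy2 X \<and> abs_q2 X = y)"
  unfolding q2.pcr_cr_eq cr_q2_def q2rel_def by auto

lemma Domainp_pcr_q2 [transfer_domain_rule]: "Domainp pcr_q2 = cauchy2"
  by (simp add: q2.domain_eq q2rel_def)

instantiation q2 :: field
begin

lift_definition zero_q2 :: q2 is "\<lambda>n. 0"
  by (simp add: q2rel_refl)

lift_definition one_q2 :: q2 is "\<lambda>n. 1"
  by (simp add: q2rel_refl)

lift_definition plus_q2 :: "q2 \<Rightarrow> q2 \<Rightarrow> q2" is "\<lambda>X Y n. X n + Y n"
  unfolding q2rel_def add_diff_add
  by (simp only: cauchy2_add vanishes2_add simp_thms)

lift_definition uminus_q2 :: "q2 \<Rightarrow> q2" is "\<lambda>X n. - X n"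
  unfolding q2rel_def minus_diff_minus
  by (simp only: cauchy2_minus vanishes2_minus simp_thms)

lift_definition minus_q2 :: "q2 \<Rightarrow> q2 \<Rightarrow> q2" is "\<lambda>X Y n. X n - Y n"
  unfolding q2rel_def
  by (auto simp: cauchy2_diff dest: vanishes2_diff simp: algebra_simps)

lift_definition times_q2 :: "q2 \<Rightarrow> q2 \<Rightarrow> q2" is "\<lambda>X Y n. X n * Y n"
proof -
  fix f1 f2 f3 f4
  have "\<lbrakk>cauchy2 f1; cauchy2 f4; vanishes2 (\<lambda>n. f1 n - f2 n); vanishes2 (\<lambda>n. f3 n - f4 n)\<rbrakk>
       \<Longrightarrow> vanishes2 (\<lambda>n. f1 n * (f3 n - f4 n) + f4 n * (f1 n - f2 n))"
    by (simp add: vanishes2_add vanishes2_mult_bounded)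
  then show "\<lbrakk>q2rel f1 f2; q2rel f3 f4\<rbrakk> \<Longrightarrow> q2rel (\<lambda>n. f1 n * f3 n) (\<lambda>n. f2 n * f4 n)"
    by (simp add: mult.commute q2rel_def mult_diff_mult cauchy2_mult)
qed

lift_definition inverse_q2 :: "q2 \<Rightarrow> q2"
  is "\<lambda>X. if vanishes2 X then (\<lambda>n. 0) else (\<lambda>n. inverse (X n))"
proof -
  fix X Y
  assume "q2rel X Y"
  then have X: "cauchy2 X" and Y: "cauchy2 Y" and XY: "vanishes2 (\<lambda>n. X n - Y n)"
    by (simp_all add: q2rel_def)
  have "vanishes2 X \<longleftrightarrow> vanishes2 Y"
    using vanishes2_diff[OF _ XY, of X] vanishes2_add[OF _ XY, of Y] by auto
  then show "?thesis X Y"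
    by (simp add: vanishes2_diff_inverse cauchy2_inverse X Y XY q2rel_def)
qed

definition "x div y = x * inverse y" for x y :: q2

instance
proof
  fix a b c :: q2
  show "a + b = b + a"
    by transfer (simp add: ac_simps q2rel_def cauchy2_add)
  show "(a + b) + c = a + (b + c)"
    by transfer (simp add: ac_simps q2rel_def cauchy2_add)
  show "0 + a = a"
    by transfer (simp add: q2rel_def)
  show "- a + a = 0"
    by transfer (simp add: q2rel_def)
  show "a - b = a + - b"
    by transfer (simp add: q2rel_def cauchy2_diff)
  show "(a * b) * c = a * (b * c)"
    by transfer (simp add: ac_simps q2rel_def cauchy2_mult)
  show "a * b = b * a"
    by transfer (simp add: ac_simps q2rel_def cauchy2_mult)
  show "1 * a = a"
    by transfer (simp add: q2rel_def)
  show "(a + b) * c = a * c + b * c"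
    by transfer (simp add: distrib_right q2rel_def cauchy2_mult cauchy2_add)
  show "(0::q2) \<noteq> (1::q2)"
    by transfer (simp add: q2rel_def)
  show "a \<noteq> 0 \<Longrightarrow> inverse a * a = 1"
    by transfer (simp add: q2rel_def vanishes2_inverse_mult cauchy2_mult cauchy2_inverse)
  show "a div b = a * inverse b"
    by (rule divide_q2_def)
  show "inverse (0::q2) = 0"
    by transfer (simp add: q2rel_def)
qed

end

lift_definition abs2 :: "q2 \<Rightarrow> real" is "\<lambda>X. lim (\<lambda>n. rat_abs2 (X n))"
proof -
  fix X Y
  assume "q2rel X Y"
  then have X: "cauchy2 X" and Y: "cauchy2 Y" and XY: "vanishes2 (\<lambda>n. X n - Y n)"
    by (simp_all add: q2rel_def)
  show "lim (\<lambda>n. rat_abs2 (X n)) = lim (\<lambda>n. rat_abs2 (Y n))"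
  proof (cases "vanishes2 X")
    case True
    moreover have "vanishes2 Y" using vanishes2_diff[OF True XY] by simp
    ultimately show ?thesis by (simp add: vanishes2_iff_tendsto limI)
  next
    case False
    have nY: "\<not> vanishes2 Y" using False vanishes2_add[OF XY, of Y] by auto
    obtain c M where c: "c > 0" "\<And>n. n \<ge> M \<Longrightarrow> rat_abs2 (Y n) = c"
      using cauchy2_eventually_const[OF Y nY] by blast
    obtain N where N: "\<forall>n\<ge>N. rat_abs2 (X n - Y n) < c"
      using XY c unfolding vanishes2_def by blast
    have "rat_abs2 (X n) = rat_abs2 (Y n)" if "n \<ge> max M N" for n
      using c N that by (intro rat_abs2_eq_of_close) auto
    then have "\<forall>\<^sub>F n in sequentially. rat_abs2 (X n) = rat_abs2 (Y n)"
      unfolding eventually_sequentially by blast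
    then show ?thesis
      by (simp add: lim_def tendsto_cong)
  qed
qed

lemma rat_abs2_tendsto_abs2:
  assumes "cauchy2 X"
  shows "(\<lambda>n. rat_abs2 (X n)) \<longlonglongrightarrow> abs2 (abs_q2 X)"
proof -
  have "abs2 (abs_q2 X) = lim (\<lambda>n. rat_abs2 (X n))"
    using assms by (intro abs2.abs_eq) (simp add: eq_onp_def q2rel_refl)
  moreover have "convergent (\<lambda>n. rat_abs2 (X n))"
  proof (cases "vanishes2 X")
    case True
    then show ?thesis by (auto simp: vanishes2_iff_tendsto convergent_def)
  next
    case False
    obtain c M where "c > 0" "\<And>n. n \<ge> M \<Longrightarrow> rat_abs2 (X n) = c"
      using cauchy2_eventually_const[OF assms False] by blast
    then have "(\<lambda>n. rat_abs2 (X n)) \<longlonglongrightarrow> c"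
      by (intro tendsto_eventually) (auto simp: eventually_sequentially)
    then show ?thesis by (auto simp: convergent_def)
  qed
  ultimately show ?thesis by (simp add: convergent_LIMSEQ_iff)
qed

lemma q2_cases:
  obtains X where "cauchy2 X" "x = abs_q2 X"
  by (metis Quotient_abs_rep[OF Quotient_q2] Quotient_rep_reflp[OF Quotient_q2] q2rel_def)

lemma abs_q2_add: "cauchy2 X \<Longrightarrow> cauchy2 Y \<Longrightarrow> abs_q2 X + abs_q2 Y = abs_q2 (\<lambda>n. X n + Y n)"
  using plus_q2.transfer by (simp add: cr_q2_eq rel_fun_def)

lemma abs_q2_diff: "cauchy2 X \<Longrightarrow> cauchy2 Y \<Longrightarrow> abs_q2 X - abs_q2 Y = abs_q2 (\<lambda>n. X n - Y n)"
  using minus_q2.transfer by (simp add: cr_q2_eq rel_fun_def)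

lemma abs_q2_mult: "cauchy2 X \<Longrightarrow> cauchy2 Y \<Longrightarrow> abs_q2 X * abs_q2 Y = abs_q2 (\<lambda>n. X n * Y n)"
  using times_q2.transfer by (simp add: cr_q2_eq rel_fun_def)

lemma abs_q2_eq_0_iff: "cauchy2 X \<Longrightarrow> abs_q2 X = 0 \<longleftrightarrow> vanishes2 X"
  using Quotient_rel[OF Quotient_q2, of X "\<lambda>n. 0"] by (auto simp: zero_q2_def q2rel_def)

lemma abs2_nonneg [simp]: "abs2 x \<ge> 0"
proof (cases x rule: q2_cases)
  case (1 X)
  then show ?thesis
    using rat_abs2_tendsto_abs2[of X] by (auto intro: LIMSEQ_le_const)
qed

lemma abs2_eq_0_iff [simp]: "abs2 x = 0 \<longleftrightarrow> x = 0"
proof (cases x rule: q2_cases)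
  case (1 X)
  have "abs2 x = 0 \<longleftrightarrow> vanishes2 X"
    using rat_abs2_tendsto_abs2[of X] 1 LIMSEQ_unique by (auto simp: vanishes2_iff_tendsto)
  then show ?thesis using 1 by (simp add: abs_q2_eq_0_iff)
qed

lemma abs2_0 [simp]: "abs2 0 = 0"
  by simp

lemma abs2_mult: "abs2 (x * y) = abs2 x * abs2 y"
proof (cases x rule: q2_cases; cases y rule: q2_cases)
  fix X Y assume *: "cauchy2 X" "x = abs_q2 X" "cauchy2 Y" "y = abs_q2 Y"
  have "(\<lambda>n. rat_abs2 (X n * Y n)) \<longlonglongrightarrow> abs2 x * abs2 y"
    using rat_abs2_tendsto_abs2 * unfolding rat_abs2_mult by (intro tendsto_mult) auto
  moreover have "(\<lambda>n. rat_abs2 (X n * Y n)) \<longlonglongrightarrow> abs2 (x * y)"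
    using * by (simp add: abs_q2_mult rat_abs2_tendsto_abs2 cauchy2_mult)
  ultimately show ?thesis using LIMSEQ_unique by blast
qed

lemma abs2_add: "abs2 (x + y) \<le> max (abs2 x) (abs2 y)"
proof (cases x rule: q2_cases; cases y rule: q2_cases)
  fix X Y assume *: "cauchy2 X" "x = abs_q2 X" "cauchy2 Y" "y = abs_q2 Y"
  have "(\<lambda>n. max (rat_abs2 (X n)) (rat_abs2 (Y n))) \<longlonglongrightarrow> max (abs2 x) (abs2 y)"
    using rat_abs2_tendsto_abs2 * by (intro tendsto_max) auto
  moreover have "(\<lambda>n. rat_abs2 (X n + Y n)) \<longlonglongrightarrow> abs2 (x + y)"
    using * by (simp add: abs_q2_add rat_abs2_tendsto_abs2 cauchy2_add)
  ultimately show ?thesis using rat_abs2_add by (blast intro: LIMSEQ_le)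
qed

lemma abs2_1 [simp]: "abs2 1 = 1"
  using abs2_mult[of 1 1] abs2_eq_0_iff[of 1] by simp

lemma abs2_minus [simp]: "abs2 (- x) = abs2 x"
proof -
  have "abs2 (-1) * abs2 (-1) = 1"
    by (simp flip: abs2_mult)
  then have "abs2 (-1) = 1"
    using abs2_nonneg[of "-1"] by (metis abs_of_nonneg abs_1 real_sqrt_abs2 real_sqrt_one)
  then show ?thesis using abs2_mult[of "-1" x] by simp
qed

lemma abs2_diff_commute: "abs2 (x - y) = abs2 (y - x)"
  using abs2_minus[of "x - y"] by simp

lemma abs2_diff: "abs2 (x - y) \<le> max (abs2 x) (abs2 y)"
  using abs2_add[of x "- y"] by simp

lemma abs2_diff_trans: "abs2 (x - z) \<le> max (abs2 (x - y)) (abs2 (y - z))"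
  using abs2_add[of "x - y" "y - z"] by simp

lemma abs2_inverse: "abs2 (inverse x) = inverse (abs2 x)"
proof (cases "x = 0")
  case False
  then have "abs2 x * abs2 (inverse x) = 1"
    by (simp flip: abs2_mult)
  then show ?thesis by (simp add: inverse_unique)
qed auto

lemma abs2_divide: "abs2 (x / y) = abs2 x / abs2 y"
  by (simp add: divide_inverse abs2_mult abs2_inverse)

lemma abs_q2_of_nat: "of_nat k = abs_q2 (\<lambda>n. of_nat k)"
  by (induct k) (simp_all add: zero_q2_def one_q2_def abs_q2_add)

instance q2 :: field_char_0
proof
  have "k = l" if "of_nat k = (of_nat l :: q2)" for k l
  proof -
    have "vanishes2 (\<lambda>n. of_nat k - of_nat l :: rat)"
      using that Quotient_rel[OF Quotient_q2, of "\<lambda>n. of_nat k" "\<lambda>n. of_nat l"]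
      by (auto simp: abs_q2_of_nat q2rel_def)
    then show ?thesis by simp
  qed
  then show "inj (of_nat :: nat \<Rightarrow> q2)" by (rule injI)
qed

lemma abs_q2_of_int: "of_int k = abs_q2 (\<lambda>n. of_int k)"
  by (cases k rule: int_diff_cases) (simp add: abs_q2_of_nat abs_q2_diff)

lemma abs_q2_of_rat: "of_rat r = abs_q2 (\<lambda>n. r)"
proof -
  obtain a b where r: "r = of_int a / of_int b" "b \<noteq> 0" by (rule rat_cases_int)
  have "abs_q2 (\<lambda>n. r) * of_int b = of_int a"
    using r by (simp add: abs_q2_of_int abs_q2_mult)
  moreover have "of_rat r * of_int b = (of_int a :: q2)"
    using r by (simp add: of_rat_divide)
  ultimately show ?thesis using r
    by (metis mult_right_cancel of_int_eq_0_iff)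
qed

lemma abs2_of_rat: "abs2 (of_rat r) = rat_abs2 r"
  using rat_abs2_tendsto_abs2[of "\<lambda>n. r"] by (simp add: abs_q2_of_rat LIMSEQ_const_iff)

lemma abs2_2: "abs2 2 = 1 / 2"
  using abs2_of_rat[of 2] by (simp add: rat_abs2_2)

instantiation q2 :: metric_space
begin

definition dist_q2 :: "q2 \<Rightarrow> q2 \<Rightarrow> real" where
  "dist_q2 x y = abs2 (x - y)"

definition uniformity_q2 :: "(q2 \<times> q2) filter" where
  "uniformity_q2 = (INF e\<in>{0<..}. principal {(x, y). dist x y < e})"

definition open_q2 :: "q2 set \<Rightarrow> bool" where
  "open_q2 U \<longleftrightarrow> (\<forall>x\<in>U. eventually (\<lambda>(x', y). x' = x \<longrightarrow> y \<in> U) uniformity)"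

instance
proof
  show "dist x y \<le> dist x z + dist y z" for x y z :: q2
    using abs2_diff_trans[of x y z] abs2_nonneg[of "x - z"] abs2_nonneg[of "z - y"]
    unfolding dist_q2_def abs2_diff_commute[of y z] by linarith
qed (simp_all add: dist_q2_def uniformity_q2_def open_q2_def)

end

lemma abs_q2_approx:
  assumes "cauchy2 X"
  shows "(\<lambda>n. of_rat (X n)) \<longlonglongrightarrow> abs_q2 X"
proof (rule metric_LIMSEQ_I)
  fix e :: real assume "e > 0"
  then obtain M where M: "\<forall>m\<ge>M. \<forall>n\<ge>M. rat_abs2 (X m - X n) < e / 2"
    using assms unfolding cauchy2_def by (meson half_gt_zero)
  have "dist (of_rat (X n)) (abs_q2 X) < e" if "n \<ge> M" for n
  proof -
    have "(\<lambda>m. rat_abs2 (X n - X m)) \<longlonglongrightarrow> abs2 (of_rat (X n) - abs_q2 X)"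
      using assms by (simp add: abs_q2_of_rat abs_q2_diff rat_abs2_tendsto_abs2 cauchy2_diff)
    then have "abs2 (of_rat (X n) - abs_q2 X) \<le> e / 2"
      using M that by (intro LIMSEQ_le_const2) (auto intro!: exI[of _ M] less_imp_le)
    then show ?thesis using \<open>e > 0\<close> by (simp add: dist_q2_def)
  qed
  then show "\<exists>no. \<forall>n\<ge>no. dist (of_rat (X n)) (abs_q2 X) < e" by blast
qed

lemma Rats_dense_q2: "closure (\<rat> :: q2 set) = UNIV"
proof -
  have "x \<in> closure \<rat>" for x :: q2
    by (cases x rule: q2_cases)
       (auto simp: closure_sequential intro!: exI[of _ "\<lambda>n. of_rat (_ n)"] abs_q2_approx)
  then show ?thesis by blast
qed

instance q2 :: complete_space
proof
  fix x :: "nat \<Rightarrow> q2"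
  assume x: "Cauchy x"
  have "\<exists>r. dist (of_rat r) (x n) < 1 / real (Suc n)" for n
  proof (cases "x n" rule: q2_cases)
    case (1 X)
    then show ?thesis
      using metric_LIMSEQ_D[OF abs_q2_approx, of X "1 / real (Suc n)"] by fastforce
  qed
  then obtain r where r: "\<And>n. dist (of_rat (r n)) (x n) < 1 / real (Suc n)" by metis
  have lim: "(\<lambda>n. dist (of_rat (r n)) (x n)) \<longlonglongrightarrow> 0"
    by (rule tendsto_sandwich[OF _ _ tendsto_const LIMSEQ_inverse_real_of_nat])
       (use r in \<open>auto simp: inverse_eq_divide intro: less_imp_le always_eventually\<close>)
  have "cauchy2 r"
    unfolding cauchy2_def
  proof (intro allI impI)
    fix e :: real assume e: "e > 0"
    obtain M where M: "\<forall>m\<ge>M. \<forall>n\<ge>M. dist (x m) (x n) < e / 3"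
      using x e unfolding Cauchy_def by (meson divide_pos_pos zero_less_numeral)
    obtain N where N: "\<forall>n\<ge>N. dist (of_rat (r n)) (x n) < e / 3"
      using order_tendstoD(2)[OF lim, of "e / 3"] e by (auto simp: eventually_sequentially)
    have "rat_abs2 (r m - r n) < e" if "m \<ge> max M N" "n \<ge> max M N" for m n
    proof -
      have "rat_abs2 (r m - r n) = dist (of_rat (r m)) (of_rat (r n) :: q2)"
        by (simp add: dist_q2_def flip: of_rat_diff abs2_of_rat)
      also have "\<dots> \<le> dist (of_rat (r m)) (x m) + dist (x m) (x n) + dist (of_rat (r n)) (x n)"
        by (metis dist_commute dist_triangle_le add.assoc add_mono dist_triangle order_refl)
      also have "\<dots> < e / 3 + e / 3 + e / 3"
        using M N that by (intro add_strict_mono) auto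
      finally show ?thesis by simp
    qed
    then show "\<exists>M. \<forall>m\<ge>M. \<forall>n\<ge>M. rat_abs2 (r m - r n) < e" by blast
  qed
  then have "(\<lambda>n. of_rat (r n)) \<longlonglongrightarrow> abs_q2 r" by (rule abs_q2_approx)
  moreover have "(\<lambda>n. dist (x n) (of_rat (r n))) \<longlonglongrightarrow> 0"
    using lim by (simp add: dist_commute)
  ultimately have sum: "(\<lambda>n. dist (x n) (of_rat (r n)) + dist (of_rat (r n)) (abs_q2 r)) \<longlonglongrightarrow> 0"
    unfolding tendsto_dist_iff[of _ "abs_q2 r"] using tendsto_add_zero by fastforce
  have "x \<longlonglongrightarrow> abs_q2 r"
    unfolding tendsto_dist_iff[of _ "abs_q2 r"]
    by (rule tendsto_sandwich[OF _ _ tendsto_const sum]) (auto simp: dist_triangle)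
  then show "convergent x" by (auto simp: convergent_def)
qed


section \<open>The projective line with the spherical metric\<close>

datatype p1 = Fin q2 | Infty

fun spherical :: "p1 \<Rightarrow> p1 \<Rightarrow> real" where
  "spherical (Fin z) (Fin w) = abs2 (z - w) / (max (abs2 z) 1 * max (abs2 w) 1)"
| "spherical (Fin z) Infty = (if abs2 z \<le> 1 then 1 else 1 / abs2 z)"
| "spherical Infty (Fin z) = (if abs2 z \<le> 1 then 1 else 1 / abs2 z)"
| "spherical Infty Infty = 0"

text \<open>The triangle inequality is proved in homogeneous coordinates normalised to
  maximum norm 1, where the spherical metric is the absolute value of a determinant.\<close>

fun hom1 :: "p1 \<Rightarrow> q2" where
  "hom1 (Fin z) = (if abs2 z \<le> 1 then z else 1)"
| "hom1 Infty = 1"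

fun hom2 :: "p1 \<Rightarrow> q2" where
  "hom2 (Fin z) = (if abs2 z \<le> 1 then 1 else inverse z)"
| "hom2 Infty = 0"

lemma spherical_eq_det: "spherical u v = abs2 (hom1 u * hom2 v - hom1 v * hom2 u)"
proof -
  have *: "abs2 (z * inverse w - 1) = abs2 (z - w) / abs2 w" if "abs2 w > 1" for z w
  proof -
    have "w \<noteq> 0" using that by auto
    then have "z * inverse w - 1 = (z - w) / w" by (simp add: field_simps)
    then show ?thesis by (simp add: abs2_divide)
  qed
  have **: "abs2 (inverse w - inverse z) = abs2 (z - w) / (abs2 z * abs2 w)"
    if "abs2 z > 1" "abs2 w > 1" for z w
  proof -
    have "w \<noteq> 0" "z \<noteq> 0" using that by auto
    then have "inverse w - inverse z = (z - w) / (z * w)" by (simp add: field_simps)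
    then show ?thesis by (simp add: abs2_divide abs2_mult)
  qed
  show ?thesis
  proof (cases u; cases v)
    fix z w assume "u = Fin z" "v = Fin w"
    then show ?thesis
      using *[of w z] *[of z w] **[of z w] abs2_diff_commute[of z w]
        abs2_diff_commute[of 1 "w * inverse z"]
      by (auto simp: max_def not_le)
  qed (auto simp: abs2_inverse divide_inverse)
qed

lemma hom_norm: "abs2 (hom1 u) \<le> 1" "abs2 (hom2 u) \<le> 1" "abs2 (hom1 u) = 1 \<or> abs2 (hom2 u) = 1"
  by (cases u; auto simp: abs2_inverse inverse_le_1_iff)+

lemma spherical_ultra: "spherical u w \<le> max (spherical u v) (spherical v w)"
proof -
  define D where "D u v = hom1 u * hom2 v - hom1 v * hom2 u" for u v
  have bound: "abs2 (D v w * c + D u v * d) \<le> max (abs2 (D u v)) (abs2 (D v w))"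
    if "abs2 c \<le> 1" "abs2 d \<le> 1" for c d
  proof -
    have "abs2 (D v w * c + D u v * d) \<le> max (abs2 (D v w) * abs2 c) (abs2 (D u v) * abs2 d)"
      by (metis abs2_add abs2_mult)
    also have "\<dots> \<le> max (abs2 (D v w)) (abs2 (D u v))"
      using that by (intro max.mono mult_left_le) auto
    finally show ?thesis by (simp add: max.commute)
  qed
  have i1: "D u w * hom1 v = D v w * hom1 u + D u v * hom1 w"
    and i2: "D u w * hom2 v = D v w * hom2 u + D u v * hom2 w"
    by (simp_all add: D_def algebra_simps)
  have "abs2 (D u w) \<le> max (abs2 (D u v)) (abs2 (D v w))"
    using hom_norm(3)[of v]
  proof
    assume "abs2 (hom1 v) = 1"
    then have "abs2 (D u w) = abs2 (D u w * hom1 v)" by (simp add: abs2_mult)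
    then show ?thesis using i1 bound[OF hom_norm(1) hom_norm(1), of u w] by simp
  next
    assume "abs2 (hom2 v) = 1"
    then have "abs2 (D u w) = abs2 (D u w * hom2 v)" by (simp add: abs2_mult)
    then show ?thesis using i2 bound[OF hom_norm(2) hom_norm(2), of u w] by simp
  qed
  then show ?thesis by (simp add: spherical_eq_det D_def)
qed

lemma spherical_commute: "spherical u v = spherical v u"
  by (simp add: spherical_eq_det abs2_diff_commute[of "hom1 u * hom2 v"])

lemma spherical_nonneg: "spherical u v \<ge> 0"
  by (simp add: spherical_eq_det)

lemma spherical_eq_0_iff: "spherical u v = 0 \<longleftrightarrow> u = v"
  by (cases u; cases v) (auto simp: max_def)

instantiation p1 :: metric_space
begin

definition dist_p1 :: "p1 \<Rightarrow> p1 \<Rightarrow> real" where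
  "dist_p1 = spherical"

definition uniformity_p1 :: "(p1 \<times> p1) filter" where
  "uniformity_p1 = (INF e\<in>{0<..}. principal {(x, y). dist x y < e})"

definition open_p1 :: "p1 set \<Rightarrow> bool" where
  "open_p1 U \<longleftrightarrow> (\<forall>x\<in>U. eventually (\<lambda>(x', y). x' = x \<longrightarrow> y \<in> U) uniformity)"

instance
proof
  show "dist x y \<le> dist x z + dist y z" for x y z :: p1
    using spherical_ultra[of x y z] spherical_nonneg[of x z] spherical_nonneg[of z y]
    unfolding dist_p1_def spherical_commute[of y z] by linarith
qed (simp_all add: dist_p1_def uniformity_p1_def open_p1_def spherical_eq_0_iff)

end


section \<open>Dynamics\<close>

definition phi :: "q2 \<Rightarrow> p1 \<Rightarrow> p1" where
  "phi a u = (case u of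
      Fin x \<Rightarrow> (if x = 0 then Infty else Fin (a * x + 1 / x))
    | Infty \<Rightarrow> Infty)"

definition proj :: "q2 \<Rightarrow> q2 \<Rightarrow> p1" where
  "proj X Y = (if Y = 0 then Infty else Fin (X / Y))"

lemma spherical_proj:
  assumes "X \<noteq> 0 \<or> Y \<noteq> 0" "X' \<noteq> 0 \<or> Y' \<noteq> 0"
  shows "spherical (proj X Y) (proj X' Y') =
    abs2 (X * Y' - X' * Y) / (max (abs2 X) (abs2 Y) * max (abs2 X') (abs2 Y'))"
proof -
  have norm: "max (abs2 (X / Y)) 1 = max (abs2 X) (abs2 Y) / abs2 Y" if "Y \<noteq> 0" for X Y
  proof -
    have "abs2 Y > 0" using that abs2_nonneg[of Y] by (simp add: less_le)
    then show ?thesis by (auto simp: max_def abs2_divide field_simps)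
  qed
  have inf: "spherical (Fin z) Infty = 1 / max (abs2 z) 1"
    and inf': "spherical Infty (Fin z) = 1 / max (abs2 z) 1" for z
    by (auto simp: max_def)
  show ?thesis
  proof (cases "Y = 0"; cases "Y' = 0")
    assume Y: "Y \<noteq> 0" "Y' \<noteq> 0"
    then have "X / Y - X' / Y' = (X * Y' - X' * Y) / (Y * Y')"
      by (simp add: field_simps)
    then show ?thesis
      using Y by (simp add: proj_def norm abs2_divide[of "X * Y' - X' * Y"] abs2_mult)
  qed (use assms in \<open>auto simp: proj_def inf inf' norm abs2_mult max_absorb1
        simp del: spherical.simps(2,3)\<close>)
qed

lemma phi_eq_proj:
  "phi a u = proj (a * (hom1 u)\<^sup>2 + (hom2 u)\<^sup>2) (hom1 u * hom2 u)"
  by (cases u) (auto simp: phi_def proj_def field_simps power2_eq_square)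

lemma continuous_phi:
  assumes a: "abs2 a > 1"
  shows "continuous_on UNIV (phi a)"
proof -
  define P where "P u = a * (hom1 u)\<^sup>2 + (hom2 u)\<^sup>2" for u
  define Q where "Q u = hom1 u * hom2 u" for u
  define N where "N u = max (abs2 (P u)) (abs2 (Q u))" for u
  have add_eq: "abs2 (x + y) = abs2 x" if "abs2 y < abs2 x" for x y
    using abs2_add[of x y] abs2_diff[of "x + y" y] that by simp
  have N: "N u \<ge> 1 / abs2 a" for u
  proof (cases "abs2 (hom1 u) = 1")
    case True
    have "abs2 ((hom2 u)\<^sup>2) \<le> 1"
      using hom_norm(2)[of u] by (simp add: power2_eq_square abs2_mult mult_le_one)
    then have "abs2 (P u) = abs2 a"
      unfolding P_def using True a
      by (subst add_eq) (auto simp: abs2_mult power2_eq_square)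
    then show ?thesis using a by (simp add: N_def le_max_iff_disj divide_le_eq) 
        (smt (verit) mult_le_cancel_left1)
  next
    case False
    then have 2: "abs2 (hom2 u) = 1" using hom_norm(3) by blast
    show ?thesis
    proof (cases "abs2 (hom1 u) \<ge> 1 / abs2 a")
      case True
      then show ?thesis using 2 by (simp add: N_def Q_def abs2_mult le_max_iff_disj)
    next
      case f: False
      have "abs2 a * (abs2 (hom1 u) * abs2 (hom1 u)) < 1"
      proof -
        have "abs2 a * abs2 (hom1 u) < 1" using f a by (simp add: field_simps)
        moreover have "abs2 a * abs2 (hom1 u) * abs2 (hom1 u) \<le> abs2 a * abs2 (hom1 u)"
          using hom_norm(1)[of u] by (intro mult_left_le) auto
        ultimately show ?thesis by (simp add: mult.assoc)
      qed
      then have "abs2 (P u) = 1"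
        unfolding P_def using 2
        by (subst add.commute, subst add_eq) (auto simp: abs2_mult power2_eq_square)
      then show ?thesis using a by (simp add: N_def le_max_iff_disj)
    qed
  qed
  have nz: "P u \<noteq> 0 \<or> Q u \<noteq> 0" for u
  proof (rule ccontr)
    assume "\<not> ?thesis"
    then have "N u = 0" by (simp add: N_def)
    then show False using N[of u] a by simp
  qed
  have lip: "dist (phi a u) (phi a v) \<le> abs2 a ^ 3 * dist u v" for u v
  proof -
    let ?c = "a * (hom1 u * hom1 v) - hom2 u * hom2 v"
    have "abs2 ?c \<le> max (abs2 (a * (hom1 u * hom1 v))) (abs2 (hom2 u * hom2 v))"
      by (rule abs2_diff)
    also have "\<dots> \<le> max (abs2 a * 1) (abs2 a)"
      unfolding abs2_mult using a hom_norm(1,2)[of u] hom_norm(1,2)[of v]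
      by (intro max.mono mult_left_mono mult_le_one order.trans[OF mult_le_one, of _ _ "abs2 a"])
         auto
    finally have c: "abs2 ?c \<le> abs2 a" by simp
    have "P u * Q v - P v * Q u = (hom1 u * hom2 v - hom1 v * hom2 u) * ?c"
      by (simp add: P_def Q_def algebra_simps power2_eq_square)
    then have "abs2 (P u * Q v - P v * Q u) = dist u v * abs2 ?c"
      by (simp add: abs2_mult dist_p1_def spherical_eq_det)
    then have "dist (phi a u) (phi a v) = dist u v * abs2 ?c / (N u * N v)"
      using spherical_proj[OF nz[of u] nz[of v]]
      unfolding dist_p1_def phi_eq_proj N_def P_def Q_def by simp
    also have "\<dots> \<le> dist u v * abs2 a / (1 / abs2 a * (1 / abs2 a))"
      using a c N[of u] N[of v]
      by (intro frac_le mult_left_mono mult_mono) (auto intro: order.trans[OF _ N])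
    also have "\<dots> = abs2 a ^ 3 * dist u v"
      by (simp add: power3_eq_cube)
    finally show ?thesis .
  qed
  show ?thesis
    by (rule lipschitz_on_continuous_on[of "abs2 a ^ 3"], rule lipschitz_onI)
       (use lip a in auto)
qed

definition equicontinuous_at :: "'a::metric_space set \<Rightarrow> ('a \<Rightarrow> 'b::metric_space) set \<Rightarrow> 'a \<Rightarrow> bool" where
  "equicontinuous_at U F x \<longleftrightarrow>
     (\<forall>e>0. \<exists>d>0. \<forall>f\<in>F. \<forall>y\<in>U. dist x y < d \<longrightarrow> dist (f x) (f y) < e)"

definition equicontinuous_on :: "'a::metric_space set \<Rightarrow> ('a \<Rightarrow> 'b::metric_space) set \<Rightarrow> bool" where
  "equicontinuous_on U F \<longleftrightarrow> (\<forall>x\<in>U. equicontinuous_at U F x)"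

definition fatou_set :: "('a::metric_space \<Rightarrow> 'a) \<Rightarrow> 'a set" where
  "fatou_set f = {z. \<exists>U. open U \<and> z \<in> U \<and> equicontinuous_on U {f ^^ n | n. n \<ge> 1}}"

definition julia_set :: "('a::metric_space \<Rightarrow> 'a) \<Rightarrow> 'a set" where
  "julia_set f = UNIV - fatou_set f"

text \<open>The function type carries the product of the discrete topologies on \<^typ>\<open>nat\<close>,
  so \<open>Sigma2\<close> as a subspace is the product of copies of the discrete space \<open>{0, 1}\<close>.\<close>

definition Sigma2 :: "(nat \<Rightarrow> nat) set" where
  "Sigma2 = {s. \<forall>i. s i \<in> {0, 1}}"

definition left_shift :: "(nat \<Rightarrow> 'a) \<Rightarrow> (nat \<Rightarrow> 'a)" where
  "left_shift s = (\<lambda>i. s (i + 1))"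

text \<open>The invariance conditions say that \<open>f\<close> and \<open>g\<close> restrict to self-maps of \<open>Y\<close> and \<open>Z\<close>.\<close>

definition topologically_conjugate ::
  "'a::topological_space set \<Rightarrow> ('a \<Rightarrow> 'a) \<Rightarrow> 'b::topological_space set \<Rightarrow> ('b \<Rightarrow> 'b) \<Rightarrow> bool" where
  "topologically_conjugate Y f Z g \<longleftrightarrow>
     f ` Y \<subseteq> Y \<and> g ` Z \<subseteq> Z \<and>
     (\<exists>h k. homeomorphism Y Z h k \<and> (\<forall>y\<in>Y. h (f y) = g (h y)))"

end

theory Submission
  imports Defs
begin

text \<open>
  Put \<open>r = 1 / sqrt |a|\<close>. Off the sphere \<open>|x| = r\<close> one of the terms \<open>a x\<close>, \<open>1 / x\<close> dominates,
  and a single step reaches the region \<open>|x| > 1\<close>, on which the distance to infinity is divided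
  by \<open>|a|\<close> at every step. So the only points not attracted to infinity (locally uniformly) are
  those whose whole orbit lies on the sphere. If \<open>x\<close> and \<open>\<phi>(x)\<close> both lie on it, then
  \<open>(1 - a) x\<^sup>2\<close> is within \<open>1 / 8\<close> of \<open>1\<close>, hence a square, and so is \<open>1 - a\<close>.

  If \<open>1 - a = b\<^sup>2\<close>, the points of the sphere that stay on it for one step form two disjoint balls
  of radius \<open>1 / |b|\<^sup>3\<close> around the fixed points \<open>1 / b\<close> and \<open>- 1 / b\<close>. Each is expanded by the
  exact factor \<open>|a| / 2 \<ge> 2\<close> onto the whole sphere, so itineraries conjugate the set of
  remaining points with the full shift, and expansion rules out equicontinuity there.
\<close>

section \<open>The value group and the residue field\<close>

lemma abs2_power: "abs2 (x ^ n) = abs2 x ^ n"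
  by (induction n) (auto simp: abs2_mult)

lemma abs2_pos_iff: "abs2 x > 0 \<longleftrightarrow> x \<noteq> 0"
  using abs2_nonneg[of x] abs2_eq_0_iff[of x] by linarith

lemma abs2_add_eq: "abs2 y < abs2 x \<Longrightarrow> abs2 (x + y) = abs2 x"
  using abs2_add[of x y] abs2_diff[of "x + y" y] by simp

lemma abs2_eq_of_close: "abs2 (x - y) < abs2 y \<Longrightarrow> abs2 x = abs2 y"
  using abs2_add_eq[of "x - y" y] by simp

lemma abs2_add_le: "abs2 x \<le> e \<Longrightarrow> abs2 y \<le> e \<Longrightarrow> abs2 (x + y) \<le> e"
  using abs2_add[of x y] by simp

lemma abs2_diff_le: "abs2 x \<le> e \<Longrightarrow> abs2 y \<le> e \<Longrightarrow> abs2 (x - y) \<le> e"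
  using abs2_diff[of x y] by simp

lemma ex_of_rat_close:
  assumes "e > 0"
  obtains q where "abs2 (x - of_rat q) < e"
proof (cases x rule: q2_cases)
  case (1 X)
  then show ?thesis
    using metric_LIMSEQ_D[OF abs_q2_approx, of X e] assms that
    by (metis dist_q2_def abs2_diff_commute order_refl)
qed

text \<open>By the ultrametric inequality a rational closer to \<open>x\<close> than
  \<open>abs2 x\<close> has the same absolute value, so no values beyond those of rationals
  occur.\<close>

lemma abs2_eq_powi:
  assumes "x \<noteq> 0"
  obtains k where "abs2 x = 2 powi k"
proof -
  obtain q where q: "abs2 (x - of_rat q) < abs2 x"
    using assms by (auto simp: abs2_pos_iff intro: ex_of_rat_close[of "abs2 x" x])
  then have "abs2 x = rat_abs2 q"
    using abs2_eq_of_close[of "of_rat q" x] by (simp add: abs2_diff_commute abs2_of_rat)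
  moreover from this have "q \<noteq> 0" using assms by auto
  ultimately show ?thesis using that by (auto simp: rat_abs2_def)
qed

text \<open>The value group is discrete: no power of 2 lies strictly between 1/2 and 1.\<close>

lemma abs2_less_oneD:
  assumes "abs2 x < 1"
  shows "abs2 x \<le> 1 / 2"
proof (cases "x = 0")
  case False
  then obtain k where k: "abs2 x = 2 powi k" by (rule abs2_eq_powi)
  have "k < 0"
  proof (rule ccontr)
    assume "\<not> k < 0"
    then have "(1::real) \<le> 2 powi k" by (intro one_le_power_int) auto
    then show False using k assms by simp
  qed
  then have "(2::real) powi k \<le> 2 powi (-1)" by (intro power_int_increasing) auto
  then show ?thesis using k by (simp add: power_int_minus)
qed auto

lemma abs2_gt_oneD:
  assumes "abs2 x > 1"
  shows "abs2 x \<ge> 2"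
proof -
  have "abs2 (inverse x) < 1" using assms by (simp add: abs2_inverse inverse_less_1_iff)
  then show ?thesis
    using abs2_less_oneD[of "inverse x"] assms by (simp only: abs2_inverse) (simp add: field_simps)
qed

text \<open>In lowest terms, equal multiplicities of 2 force numerator and denominator to be odd, so
  their difference is even.\<close>

lemma rat_abs2_diff_one:
  assumes "rat_abs2 q = 1"
  shows "rat_abs2 (q - 1) \<le> 1 / 2"
proof -
  obtain c d where cd: "quotient_of q = (c, d)" by fastforce
  then have d: "d > 0" and q: "q = of_int c / of_int d" and cop: "coprime c d"
    by (auto simp: quotient_of_denom_pos quotient_of_div quotient_of_coprime)
  have "q \<noteq> 0" using assms by auto
  then have c: "c \<noteq> 0" using q by auto
  have powi_eq_1: "k = 0" if "(2::real) powi k = 1" for k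
    using one_less_power_int[of "2::real" k] one_less_power_int[of "2::real" "-k"] that
    by (cases k "0::int" rule: linorder_cases) (auto simp: power_int_minus)
  have m: "multiplicity 2 c = multiplicity 2 d"
    using assms c d powi_eq_1 unfolding q by (fastforce simp: rat_abs2_divide)
  have iff: "even k \<longleftrightarrow> multiplicity 2 k \<noteq> 0" if "k \<noteq> 0" for k :: int
    using that by (simp add: multiplicity_eq_zero_iff)
  have "even c \<longleftrightarrow> even d" using iff c d m by simp
  then have odd: "odd c" "odd d" using cop by (auto dest: coprime_common_divisor)
  show ?thesis
  proof (cases "c = d")
    case True
    then show ?thesis using q d by simp
  next
    case False
    have "multiplicity 2 (c - d) \<ge> 1"
      using odd False by (intro multiplicity_geI) auto
    moreover have "q - 1 = of_int (c - d) / of_int d" using q d by (simp add: field_simps)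
    then have "rat_abs2 (q - 1) = 2 powi (int (multiplicity 2 d) - int (multiplicity 2 (c - d)))"
      using False d by (simp only: rat_abs2_divide)
    moreover have "multiplicity 2 d = 0" using odd by (simp add: not_dvd_imp_multiplicity_0)
    moreover have "2 powi (int 0 - int m) \<le> (2::real) powi (-1)" if "m \<ge> 1" for m
      using that by (intro power_int_increasing) auto
    ultimately show ?thesis by (simp add: power_int_minus)
  qed
qed

text \<open>The residue field has only two elements, so a sphere of radius \<open>r\<close> is a ball of
  radius \<open>r / 2\<close>.\<close>

lemma abs2_diff_sphere:
  assumes "abs2 x = abs2 y"
  shows "abs2 (x - y) \<le> abs2 y / 2"
proof (cases "y = 0")
  case True
  then show ?thesis using assms by simp
next
  case False
  define z where "z = x / y"
  have z: "abs2 z = 1" using assms False by (simp add: z_def abs2_divide)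
  obtain q where q: "abs2 (z - of_rat q) < 1 / 2" using ex_of_rat_close[of "1/2"] by auto
  have "abs2 (of_rat q) = 1"
    using abs2_eq_of_close[of "of_rat q" z] q z by (simp add: abs2_diff_commute)
  then have "rat_abs2 (q - 1) \<le> 1 / 2" by (intro rat_abs2_diff_one) (simp add: abs2_of_rat)
  then have "abs2 (of_rat q - 1) \<le> 1 / 2" by (metis abs2_of_rat of_rat_1 of_rat_diff)
  then have "abs2 (z - 1) \<le> 1 / 2"
    using abs2_add_le[of "z - of_rat q" "1/2" "of_rat q - 1"] q by simp
  moreover have "x - y = (z - 1) * y" using False by (simp add: z_def field_simps)
  ultimately show ?thesis using mult_right_mono[of "abs2 (z - 1)" "1/2" "abs2 y"] by (simp add: abs2_mult)
qed

section \<open>Complete balls and square roots near 1\<close>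

lemma complete_abs2_ball: "complete {x. abs2 (x - c) \<le> e}"
proof -
  have "{x. abs2 (x - c) \<le> e} = cball c e"
    by (auto simp: dist_q2_def abs2_diff_commute)
  then show ?thesis by (simp add: complete_eq_closed)
qed

text \<open>Writing the root as \<open>1 + 2 t\<close> turns \<open>z\<^sup>2 = 1 + d\<close> into the fixed point equation
  \<open>t = d / 4 - t\<^sup>2\<close>, which is a contraction on \<open>2 \<int>\<^sub>2\<close>.\<close>

lemma square_near_one:
  assumes "abs2 d \<le> 1 / 8"
  obtains z :: q2 where "z\<^sup>2 = 1 + d"
proof -
  let ?S = "{t::q2. abs2 (t - 0) \<le> 1 / 2}" and ?g = "\<lambda>t. d / 4 - t\<^sup>2"
  have four: "abs2 4 = 1 / 4"
    using abs2_mult[of 2 2] by (simp add: abs2_2)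
  have d4: "abs2 (d / 4) \<le> 1 / 2" using assms by (simp add: abs2_divide four)
  have "\<exists>!t. t \<in> ?S \<and> ?g t = t"
  proof (rule Banach_fix)
    show "complete ?S" by (rule complete_abs2_ball)
    show "?S \<noteq> {}" by (auto intro: exI[of _ 0])
    show "?g ` ?S \<subseteq> ?S"
    proof (intro image_subsetI)
      fix t assume "t \<in> ?S"
      then have t: "abs2 t \<le> 1 / 2" by simp
      have "abs2 (t\<^sup>2) \<le> 1/2"
        using mult_mono[OF t t] by (simp add: power2_eq_square abs2_mult)
      then show "d / 4 - t\<^sup>2 \<in> ?S" using abs2_diff_le[OF d4] by simp
    qed
    show "dist (?g s) (?g t) \<le> 1/2 * dist s t" if "s \<in> ?S" "t \<in> ?S" for s t
    proof -
      have "?g s - ?g t = - (s + t) * (s - t)" by (simp add: power2_eq_square algebra_simps)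
      then have "dist (?g s) (?g t) = abs2 (s + t) * dist s t"
        by (metis dist_q2_def abs2_mult abs2_minus)
      moreover have "abs2 (s + t) \<le> 1 / 2" using that by (intro abs2_add_le) auto
      ultimately show ?thesis using mult_right_mono[of "abs2 (s + t)" "1/2" "dist s t"] by simp
    qed
  qed auto
  then obtain t where "d / 4 - t\<^sup>2 = t" by blast
  then have "d = 4 * (t + t\<^sup>2)" by (simp add: field_simps)
  then have "(1 + 2 * t)\<^sup>2 = 1 + d" by (simp add: power2_eq_square algebra_simps)
  then show ?thesis by (rule that)
qed


section \<open>The basin of infinity\<close>

text \<open>The affine form of \<open>phi a\<close>. At 0 division gives the default value 0 whereas
  \<open>phi a\<close> gives \<open>Infty\<close>, so the two are linked only away from 0.\<close>

definition phi_fin :: "q2 \<Rightarrow> q2 \<Rightarrow> q2" where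
  "phi_fin a x = a * x + 1 / x"

lemma phi_Fin: "x \<noteq> 0 \<Longrightarrow> phi a (Fin x) = Fin (phi_fin a x)"
  by (simp add: phi_def phi_fin_def)

text \<open>The second factor is the secant slope; its size yields the expansion on
  \<open>D i\<close> and the Lipschitz bound on \<open>J\<close>.\<close>

lemma phi_fin_diff:
  "x \<noteq> 0 \<Longrightarrow> y \<noteq> 0 \<Longrightarrow> phi_fin a x - phi_fin a y = (x - y) * (a - 1 / (x * y))"
  by (simp add: phi_fin_def field_simps)

lemma dist_Fin: "abs2 x \<le> 1 \<Longrightarrow> abs2 y \<le> 1 \<Longrightarrow> dist (Fin x) (Fin y) = dist x y"
  by (simp add: dist_p1_def dist_q2_def max_absorb2)

lemma dist_Infty_less_1_iff: "dist u Infty < 1 \<longleftrightarrow> (\<forall>x. u = Fin x \<longrightarrow> abs2 x > 1)"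
  by (cases u) (auto simp: dist_p1_def)

text \<open>For |x| > 1 the distance to infinity is 1/|x|, and \<open>a * x\<close> dominates
  \<open>1 / x\<close>.\<close>

lemma dist_phi_Infty:
  assumes a: "abs2 a > 1" and u: "dist u Infty < 1"
  shows "dist (phi a u) Infty = dist u Infty / abs2 a"
proof (cases u)
  case (Fin x)
  with u have x: "abs2 x > 1" by (simp add: dist_Infty_less_1_iff)
  then have x0: "x \<noteq> 0" by auto
  have ax: "abs2 a * abs2 x > 1" using a x by (simp add: less_1_mult)
  have "abs2 (1 / x) < abs2 (a * x)"
    using ax x by (simp add: abs2_mult abs2_divide divide_less_eq less_1_mult)
  then have "abs2 (phi_fin a x) = abs2 a * abs2 x"
    unfolding phi_fin_def by (simp add: abs2_add_eq abs2_mult)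
  then show ?thesis using ax x x0 Fin by (simp add: phi_Fin dist_p1_def)
qed (simp add: phi_def dist_p1_def)

lemma dist_funpow_phi_Infty:
  assumes a: "abs2 a > 1" and u: "dist u Infty < 1"
  shows "dist ((phi a ^^ n) u) Infty = dist u Infty / abs2 a ^ n"
proof (induction n)
  case (Suc n)
  have "dist u Infty / abs2 a ^ n \<le> dist u Infty / 1"
    using a by (intro divide_left_mono) auto
  then have "dist ((phi a ^^ n) u) Infty < 1" using Suc u by simp
  then show ?case using Suc dist_phi_Infty[OF a] by simp
qed simp

section \<open>From uniform convergence to the Fatou set\<close>

lemma continuous_funpow:
  fixes f :: "'a::topological_space \<Rightarrow> 'a"
  assumes "continuous_on UNIV f"
  shows "continuous_on UNIV (f ^^ n)"
proof (induction n)
  case (Suc n)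
  then show ?case
    using continuous_on_compose[OF Suc continuous_on_subset[OF assms]] by simp
qed (simp add: continuous_on_id)

text \<open>Late members of the sequence are all within \<open>e / 2\<close> of the constant limit;
  the finitely many early ones are handled by continuity.\<close>

lemma equicontinuous_on_uniform_limit:
  fixes f :: "nat \<Rightarrow> 'a::metric_space \<Rightarrow> 'b::metric_space"
  assumes cont: "\<And>n. continuous_on UNIV (f n)" and lim: "uniform_limit U f (\<lambda>_. l) sequentially"
  shows "equicontinuous_on U {f n | n. n \<ge> m}"
  unfolding equicontinuous_on_def equicontinuous_at_def
proof (intro ballI allI impI)
  fix x and e :: real assume x: "x \<in> U" and e: "e > 0"
  have "\<forall>\<^sub>F n in sequentially. \<forall>y\<in>U. dist (f n y) l < e / 2"
    using uniform_limitD[OF lim, of "e / 2"] e by simp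
  then obtain N where N: "\<And>n y. n \<ge> N \<Longrightarrow> y \<in> U \<Longrightarrow> dist (f n y) l < e / 2"
    unfolding eventually_sequentially by blast
  have "\<exists>d>0. \<forall>y. dist x y < d \<longrightarrow> dist (f n x) (f n y) < e" for n
    using cont[of n] e unfolding continuous_on_iff by (metis UNIV_I dist_commute)
  then obtain d where d: "\<And>n. d n > 0" "\<And>n y. dist x y < d n \<Longrightarrow> dist (f n x) (f n y) < e"
    by metis
  \<comment> \<open>Inserting 1 keeps the minimum meaningful when \<open>N = 0\<close>.\<close>
  define D where "D = Min (insert 1 (d ` {..<N}))"
  have D: "D > 0" "\<And>n. n < N \<Longrightarrow> D \<le> d n" using d by (auto simp: D_def)
  have "dist (f n x) (f n y) < e" if "y \<in> U" "dist x y < D" for n y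
  proof (cases "n < N")
    case True
    then show ?thesis using D(2)[OF True] d(2) that by simp
  next
    case False
    then have "dist (f n x) l < e / 2" "dist (f n y) l < e / 2" using N x that by auto
    then show ?thesis using dist_triangle2[of "f n x" "f n y" l] by linarith
  qed
  then show "\<exists>d>0. \<forall>g\<in>{f n | n. n \<ge> m}. \<forall>y\<in>U. dist x y < d \<longrightarrow> dist (g x) (g y) < e"
    using D(1) by blast
qed

text \<open>On the open set of points that are near infinity at time \<open>m\<close>, the iterates converge to
  infinity uniformly.\<close>

lemma near_Infty_imp:
  assumes a: "abs2 a > 1" and u: "dist ((phi a ^^ m) u) Infty < 1"
  shows "u \<in> fatou_set (phi a)" and "(\<lambda>n. (phi a ^^ n) u) \<longlonglongrightarrow> Infty"
proof -
  define U where "U = (phi a ^^ m) -` ball Infty 1"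
  have cont: "continuous_on UNIV (phi a ^^ n)" for n
    by (intro continuous_funpow continuous_phi a)
  have U: "open U" "u \<in> U"
    using cont u by (auto simp: U_def dist_commute intro: open_vimage)
  have lim: "uniform_limit U (\<lambda>n. phi a ^^ n) (\<lambda>_. Infty) sequentially"
  proof (rule uniform_limitI)
    fix e :: real assume "e > 0"
    then obtain N where N: "(1 / abs2 a) ^ N < e"
      using real_arch_pow_inv[of e "1 / abs2 a"] a by auto
    have "dist ((phi a ^^ n) y) Infty < e" if n: "n \<ge> N + m" and y: "y \<in> U" for n y
    proof -
      let ?v = "(phi a ^^ m) y"
      have v: "dist ?v Infty < 1" using y by (simp add: U_def dist_commute)
      have "(phi a ^^ n) y = (phi a ^^ (n - m)) ?v"
        using n by (simp flip: funpow_add[THEN fun_cong, simplified])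
      then have "dist ((phi a ^^ n) y) Infty = dist ?v Infty * (1 / abs2 a) ^ (n - m)"
        using dist_funpow_phi_Infty[OF a v] by (simp add: power_divide)
      also have "\<dots> \<le> 1 * (1 / abs2 a) ^ N"
        using v n a by (intro mult_mono power_decreasing) auto
      finally show ?thesis using N by simp
    qed
    then show "\<forall>\<^sub>F n in sequentially. \<forall>y\<in>U. dist ((phi a ^^ n) y) Infty < e"
      unfolding eventually_sequentially by blast
  qed
  then show "u \<in> fatou_set (phi a)"
    unfolding fatou_set_def using U equicontinuous_on_uniform_limit[OF cont lim] by blast
  show "(\<lambda>n. (phi a ^^ n) u) \<longlonglongrightarrow> Infty"
    using tendsto_uniform_limitI[OF lim U(2)] .
qed

text \<open>With A = sqrt |a| and X = |x| the two terms have sizes A * A * X and 1 / X. They agree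
  only at X = 1 / A; otherwise the larger one dominates and exceeds 1.\<close>

lemma near_Infty_phi:
  assumes a: "abs2 a > 1" and u: "\<And>x. u = Fin x \<Longrightarrow> abs2 x \<noteq> 1 / sqrt (abs2 a)"
  shows "dist (phi a u) Infty < 1"
proof (cases u)
  case (Fin x)
  show ?thesis
  proof (cases "x = 0")
    case False
    define A X where "A = sqrt (abs2 a)" and "X = abs2 x"
    have A: "A > 1" "abs2 a = A\<^sup>2" using a by (simp_all add: A_def)
    have X: "X > 0" "X \<noteq> 1 / A" using False u Fin by (auto simp: X_def A_def abs2_pos_iff)
    consider "A * X > 1" | "A * X < 1" using X A by (fastforce simp: field_simps)
    then have "abs2 (phi_fin a x) > 1"
    proof cases
      case 1
      have "1 < A * X * (A * X)" using 1 by (simp add: less_1_mult)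
      then have "1 / X < A\<^sup>2 * X" using X by (simp add: field_simps power2_eq_square)
      then have "abs2 (phi_fin a x) = A\<^sup>2 * X"
        unfolding phi_fin_def by (subst abs2_add_eq) (auto simp: abs2_mult abs2_divide A X_def)
      moreover have "A * (A * X) > 1" by (rule less_1_mult[OF A(1) 1])
      ultimately show ?thesis by (simp add: power2_eq_square)
    next
      case 2
      have "A * X * (A * X) < 1 * 1" using 2 A X by (intro mult_strict_mono) auto
      then have "A\<^sup>2 * X < 1 / X" using X by (simp add: field_simps power2_eq_square)
      then have "abs2 (phi_fin a x) = 1 / X"
        unfolding phi_fin_def
        by (subst add.commute, subst abs2_add_eq) (auto simp: abs2_mult abs2_divide A X_def)
      moreover have "X < A * X" using A X by simp
      then have "X < 1" using 2 by simp
      then have "1 / X > 1" using X by simp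
      ultimately show ?thesis by simp
    qed
    then show ?thesis using Fin False by (simp add: phi_Fin dist_Infty_less_1_iff)
  qed (simp add: Fin phi_def)
qed (simp add: phi_def)

text \<open>The identity (1 - a) x^2 = 1 + x (x - f x), with f = \<open>phi_fin a\<close>, reduces
  the claim to a square root near 1. The bound 1/8 comes from |x| at most 1/2 and |x - f x| at most
  |x|/2.\<close>

lemma square_of_sphere_to_sphere:
  assumes a: "abs2 a > 1"
    and x: "abs2 x = 1 / sqrt (abs2 a)" and fx: "abs2 (phi_fin a x) = 1 / sqrt (abs2 a)"
  obtains b where "b\<^sup>2 = 1 - a"
proof -
  have "sqrt (abs2 a) > 1" using a by simp
  then have "abs2 x < 1" and x0: "x \<noteq> 0" using x by auto
  then have x2: "abs2 x \<le> 1 / 2" by (intro abs2_less_oneD)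
  have "abs2 (x - phi_fin a x) \<le> abs2 x / 2"
    using abs2_diff_sphere[of x "phi_fin a x"] x fx by simp
  then have "abs2 (x * (x - phi_fin a x)) \<le> abs2 x * (abs2 x / 2)"
    unfolding abs2_mult by (intro mult_left_mono) auto
  also have "\<dots> \<le> 1 / 2 * (1 / 2 / 2)" using x2 by (intro mult_mono) auto
  finally obtain z where z: "z\<^sup>2 = 1 + x * (x - phi_fin a x)" by (auto intro: square_near_one)
  have "x * phi_fin a x = a * x\<^sup>2 + 1"
    using x0 by (simp add: phi_fin_def algebra_simps power2_eq_square)
  then have "z\<^sup>2 = (1 - a) * x\<^sup>2" using z by (simp add: algebra_simps power2_eq_square)
  then have "(z / x)\<^sup>2 = 1 - a" using x0 by (simp add: power_divide)
  then show ?thesis by (rule that)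
qed


section \<open>Expansion and inverse branches when \<open>1 - a\<close> is a square\<close>

lemma funpow_left_shift: "(left_shift ^^ n) s = (\<lambda>i. s (i + n))"
  by (induction n) (auto simp: left_shift_def)

locale square_parameter =
  fixes a b :: q2
  assumes a_gt_1: "abs2 a > 1" and b_square: "b\<^sup>2 = 1 - a"
begin

abbreviation f :: "q2 \<Rightarrow> q2" where "f \<equiv> phi_fin a"

abbreviation B :: real where "B \<equiv> abs2 b"

text \<open>Solutions of x = a x + 1/x, that is of (1 - a) x^2 = 1. Every nonzero index denotes the
  second one.\<close>

definition fixpt :: "nat \<Rightarrow> q2" where
  "fixpt i = (if i = 0 then 1 / b else - (1 / b))"

text \<open>The sphere of radius 1/B is a ball of radius 1/(2B), and \<open>f\<close> will expand by
  B^2/2; the quotient of the two is the radius 1/B^3.\<close>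

definition D :: "nat \<Rightarrow> q2 set" where
  "D i = {x. abs2 (x - fixpt i) \<le> 1 / B ^ 3}"

lemma abs2_a: "abs2 a = B\<^sup>2"
proof -
  have "abs2 (- a + 1) = abs2 (- a)" using a_gt_1 by (intro abs2_add_eq) simp
  then show ?thesis by (simp add: b_square flip: abs2_power)
qed

lemma B_ge_2: "B \<ge> 2"
proof -
  have "B > 1" using a_gt_1 power_le_one[of B 2] unfolding abs2_a by force
  then show ?thesis by (rule abs2_gt_oneD)
qed

lemma b_nonzero: "b \<noteq> 0"
  using B_ge_2 by auto

lemma sqrt_abs2_a: "sqrt (abs2 a) = B"
  by (simp add: abs2_a)

lemma four_le_B_square: "4 \<le> B\<^sup>2"
  using mult_mono[OF B_ge_2 B_ge_2] by (simp add: power2_eq_square)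

lemma inverse_B: "0 < 1 / B" "1 / B < 1"
  using B_ge_2 by auto

lemma radius_pos: "0 < 1 / B ^ 3"
  using B_ge_2 by auto

lemma radius_less: "1 / B ^ 3 < 1 / B"
proof -
  have "B * 1 < B * B\<^sup>2" using four_le_B_square B_ge_2 by (intro mult_strict_left_mono) auto
  then have "B < B ^ 3" by (simp add: power3_eq_cube power2_eq_square)
  then show ?thesis using B_ge_2 by (intro divide_strict_left_mono) auto
qed

lemma abs2_fixpt: "abs2 (fixpt i) = 1 / B"
  by (simp add: fixpt_def abs2_divide)

lemma fixpt_square: "b\<^sup>2 * (fixpt i)\<^sup>2 = 1"
  using b_nonzero by (simp add: fixpt_def power_divide)

lemma f_fixpt: "f (fixpt i) = fixpt i"
proof -
  have a: "a = 1 - b * b" using b_square by (simp add: power2_eq_square algebra_simps)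
  show ?thesis using b_nonzero by (simp add: fixpt_def phi_fin_def a field_simps)
qed

lemma fixpt_in_D: "fixpt i \<in> D i"
  using radius_pos by (simp add: D_def)

lemma abs2_D:
  assumes "x \<in> D i"
  shows "abs2 x = 1 / B"
  using assms abs2_eq_of_close[of x "fixpt i"] radius_less by (simp add: D_def abs2_fixpt)

lemma D_nonzero: "x \<in> D i \<Longrightarrow> x \<noteq> 0"
  using abs2_D[of x i] inverse_B by auto

text \<open>In an ultrametric every point of a ball is a centre of it.\<close>

lemma D_closed:
  assumes "x \<in> D i" "abs2 (x - y) \<le> 1 / B ^ 3"
  shows "y \<in> D i"
  using assms abs2_add_le[of "y - x" "1 / B ^ 3" "x - fixpt i"]
  by (simp add: D_def abs2_diff_commute)

lemma D_diff:
  assumes "x \<in> D i" "y \<in> D i"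
  shows "abs2 (x - y) \<le> 1 / B ^ 3"
  using assms abs2_diff_le[of "x - fixpt i" "1 / B ^ 3" "y - fixpt i"] by (simp add: D_def)

text \<open>The centres differ by 2/b, of size 1/(2B), which exceeds 1/B^3 because B^2 is at least
  4.\<close>

lemma D_disjoint:
  assumes "x \<in> D 0"
  shows "x \<notin> D 1"
proof
  assume "x \<in> D 1"
  then have "abs2 ((x - fixpt 1) - (x - fixpt 0)) \<le> 1 / B ^ 3"
    using assms unfolding D_def by (intro abs2_diff_le[of "x - fixpt 1"]) auto
  moreover have "(x - fixpt 1) - (x - fixpt 0) = 2 / b" by (simp add: fixpt_def)
  ultimately have "1 / 2 / B \<le> 1 / B ^ 3" by (simp add: abs2_divide abs2_2)
  then have "B\<^sup>2 \<le> 2"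
    using b_nonzero B_ge_2 by (simp add: field_simps power2_eq_square power3_eq_cube)
  then show False using four_le_B_square by simp
qed

text \<open>Writing c for the fixed point, x y is within 1/B^4 of c^2 = 1/b^2, so 1/(x y) is within
  1 of b^2 = 1 - a. Hence the secant slope a - 1/(x y) differs from 2 a by at most 1.\<close>

lemma slope_close:
  assumes x: "x \<in> D i" and y: "y \<in> D i"
  shows "abs2 (a + 1 / (x * y)) \<le> 1"
proof -
  let ?c = "fixpt i"
  have nz: "x \<noteq> 0" "y \<noteq> 0" using x y D_nonzero by auto
  have *: "1 / B * (1 / B ^ 3) = 1 / B ^ 4" by (simp add: power_numeral_reduce)
  have "abs2 (x * (y - ?c) + ?c * (x - ?c)) \<le> 1 / B * (1 / B ^ 3)"
    using x y inverse_B unfolding D_def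
    by (intro abs2_add_le; simp only: abs2_mult abs2_fixpt abs2_D[OF x])
       (auto intro!: mult_left_mono simp del: times_divide_eq_left times_divide_eq_right)
  moreover have "x * (y - ?c) + ?c * (x - ?c) = x * y - ?c\<^sup>2"
    by (simp add: algebra_simps power2_eq_square)
  ultimately have "abs2 (x * y - ?c\<^sup>2) \<le> 1 / B ^ 4" using * by simp
  then have "B ^ 4 * abs2 (x * y - ?c\<^sup>2) \<le> B ^ 4 * (1 / B ^ 4)" by (intro mult_left_mono) auto
  then have "B ^ 4 * abs2 (x * y - ?c\<^sup>2) \<le> 1" using b_nonzero by simp
  moreover have "b\<^sup>2 * (x * y) - 1 = b\<^sup>2 * (x * y - ?c\<^sup>2)"
    using fixpt_square[of i] by (simp add: algebra_simps)
  then have "abs2 ((b\<^sup>2 * (x * y) - 1) / (x * y)) = B ^ 4 * abs2 (x * y - ?c\<^sup>2)"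
    using B_ge_2 by (simp add: abs2_divide abs2_mult abs2_power abs2_D[OF x] abs2_D[OF y])
       (simp add: power_numeral_reduce)
  ultimately have "abs2 (1 - (b\<^sup>2 * (x * y) - 1) / (x * y)) \<le> 1"
    by (intro abs2_diff_le) auto
  moreover have "1 - (b\<^sup>2 * (x * y) - 1) / (x * y) = a + 1 / (x * y)"
    using nz b_square by (simp add: diff_divide_distrib)
  ultimately show ?thesis by simp
qed

lemma abs2_two_a: "abs2 (2 * a) = B\<^sup>2 / 2"
  by (simp add: abs2_mult abs2_a abs2_2)

text \<open>The slope error is at most 1, less than |2 a|, so the ultrametric inequality makes the
  factor exactly |2 a|.\<close>

lemma f_expand:
  assumes x: "x \<in> D i" and y: "y \<in> D i"
  shows "abs2 (f x - f y) = B\<^sup>2 / 2 * abs2 (x - y)"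
proof -
  have "abs2 (- (a + 1 / (x * y))) < abs2 (2 * a)"
    unfolding abs2_minus abs2_two_a using slope_close[OF assms] four_le_B_square by linarith
  then have "abs2 (2 * a + - (a + 1 / (x * y))) = abs2 (2 * a)" by (rule abs2_add_eq)
  then have "abs2 (a - 1 / (x * y)) = B\<^sup>2 / 2" by (simp add: abs2_two_a)
  then show ?thesis using x y D_nonzero by (simp add: phi_fin_diff abs2_mult)
qed

lemma abs2_f_D:
  assumes x: "x \<in> D i"
  shows "abs2 (f x) = 1 / B"
proof -
  have "abs2 (f x - fixpt i) = B\<^sup>2 / 2 * abs2 (x - fixpt i)"
    using f_expand[OF x fixpt_in_D] by (simp add: f_fixpt)
  also have "\<dots> \<le> B\<^sup>2 / 2 * (1 / B ^ 3)" using x by (intro mult_left_mono) (auto simp: D_def)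
  also have "\<dots> = 1 / B / 2" by (simp add: power2_eq_square power3_eq_cube)
  also have "\<dots> < 1 / B" using B_ge_2 by (simp add: field_simps)
  finally show ?thesis using abs2_eq_of_close[of "f x" "fixpt i"] by (simp add: abs2_fixpt)
qed

text \<open>Here x (x - f x) equals b^2 times the product of the differences from both fixed points.
  These are 1/(2B) apart, so one difference is at least that large and the other must be
  small.\<close>

lemma sphere_cases:
  assumes x: "abs2 x = 1 / B" and fx: "abs2 (f x) = 1 / B"
  shows "x \<in> D 0 \<or> x \<in> D 1"
proof -
  have x0: "x \<noteq> 0" using x inverse_B by auto
  have "abs2 (x - f x) \<le> 1 / B / 2" using abs2_diff_sphere[of x "f x"] x fx by simp
  then have "abs2 (x * (x - f x)) \<le> 1 / B * (1 / B / 2)"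
    unfolding abs2_mult x using inverse_B by (intro mult_left_mono) auto
  moreover have "x * f x = a * x\<^sup>2 + 1"
    using x0 by (simp add: phi_fin_def algebra_simps power2_eq_square)
  then have "x * (x - f x) = x\<^sup>2 - (a * x\<^sup>2 + 1)"
    by (simp add: right_diff_distrib power2_eq_square)
  also have "\<dots> = b\<^sup>2 * x\<^sup>2 - 1" by (simp add: b_square algebra_simps)
  also have "\<dots> = b\<^sup>2 * ((x - fixpt 0) * (x - fixpt 1))"
    using b_nonzero by (simp add: fixpt_def field_simps power2_eq_square)
  ultimately have "B\<^sup>2 * (abs2 (x - fixpt 0) * abs2 (x - fixpt 1)) \<le> 1 / B * (1 / B / 2)"
    by (simp only: abs2_mult abs2_power)
  then have prod: "abs2 (x - fixpt 0) * abs2 (x - fixpt 1) \<le> 1 / B ^ 3 * (1 / (2 * B))"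
    using B_ge_2 by (simp add: field_simps power2_eq_square power3_eq_cube)
  show ?thesis
  proof (rule ccontr)
    assume "\<not> ?thesis"
    then have far: "abs2 (x - fixpt 0) > 1 / B ^ 3" "abs2 (x - fixpt 1) > 1 / B ^ 3"
      by (auto simp: D_def)
    have "abs2 ((x - fixpt 1) - (x - fixpt 0)) = 1 / (2 * B)"
      by (simp add: fixpt_def abs2_divide abs2_2)
    then have "1 / (2 * B) \<le> abs2 (x - fixpt 1) \<or> 1 / (2 * B) \<le> abs2 (x - fixpt 0)"
      using abs2_diff[of "x - fixpt 1" "x - fixpt 0"] by linarith
    then have "1 / B ^ 3 * (1 / (2 * B)) < abs2 (x - fixpt 0) * abs2 (x - fixpt 1)"
    proof
      assume "1 / (2 * B) \<le> abs2 (x - fixpt 1)"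
      then show ?thesis using far radius_pos B_ge_2 by (intro mult_less_le_imp_less) auto
    next
      assume "1 / (2 * B) \<le> abs2 (x - fixpt 0)"
      then have "1 / B ^ 3 * (1 / (2 * B)) < abs2 (x - fixpt 1) * abs2 (x - fixpt 0)"
        using far radius_pos B_ge_2 by (intro mult_less_le_imp_less) auto
      then show ?thesis by (simp add: mult.commute)
    qed
    then show False using prod by simp
  qed
qed

text \<open>The slope of \<open>f\<close> on \<open>D i\<close> is close to \<open>2 a\<close>, so the simplified Newton iteration
  for \<open>f x = y\<close> is a contraction of \<open>D i\<close>.\<close>

lemma D_onto_sphere:
  assumes y: "abs2 y = 1 / B"
  shows "\<exists>x\<in>D i. f x = y"
proof -
  let ?g = "\<lambda>x. x - (f x - y) / (2 * a)"
  have a0: "a \<noteq> 0" using a_gt_1 by auto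
  have contr: "abs2 (?g x - ?g x') \<le> 1 / 2 * abs2 (x - x')" if x: "x \<in> D i" "x' \<in> D i" for x x'
  proof -
    have nz: "x \<noteq> 0" "x' \<noteq> 0" using x D_nonzero by auto
    have "?g x - ?g x' = (x - x') - (f x - f x') / (2 * a)"
      by (simp add: diff_divide_distrib)
    also have "\<dots> = (x - x') * ((a + 1 / (x * x')) / (2 * a))"
      unfolding phi_fin_diff[OF nz] using a0 nz by (simp add: field_simps)
    finally have "abs2 (?g x - ?g x') = abs2 (x - x') * (abs2 (a + 1 / (x * x')) / (B\<^sup>2 / 2))"
      by (simp only: abs2_mult abs2_divide abs2_two_a flip: abs2_two_a)
    also have "\<dots> \<le> abs2 (x - x') * (1 / 2)"
      using slope_close[OF x] four_le_B_square
      by (intro mult_left_mono) (auto simp: divide_le_eq)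
    finally show ?thesis by simp
  qed
  \<comment> \<open>A Newton step moves the centre by at most the radius of \<open>D i\<close>; with
    the contraction this gives invariance of \<open>D i\<close>.\<close>
  have "abs2 (fixpt i - y) \<le> 1 / B / 2"
    using abs2_diff_sphere[of "fixpt i" y] y by (simp add: abs2_fixpt)
  then have "abs2 ((fixpt i - y) / (2 * a)) \<le> 1 / B / 2 / (B\<^sup>2 / 2)"
    unfolding abs2_divide abs2_two_a by (intro divide_right_mono) auto
  then have start: "abs2 ((fixpt i - y) / (2 * a)) \<le> 1 / B ^ 3"
    using B_ge_2 by (simp add: power2_eq_square power3_eq_cube mult.assoc)
  have "\<exists>!x. x \<in> D i \<and> ?g x = x"
  proof (rule Banach_fix)
    show "complete (D i)" unfolding D_def by (rule complete_abs2_ball)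
    show "D i \<noteq> {}" using fixpt_in_D by blast
    show "?g ` D i \<subseteq> D i"
    proof (intro image_subsetI)
      fix x assume x: "x \<in> D i"
      have "abs2 (?g x - ?g (fixpt i)) \<le> 1 / 2 * abs2 (x - fixpt i)"
        by (rule contr[OF x fixpt_in_D])
      also have "\<dots> \<le> 1 / B ^ 3" using x radius_pos abs2_nonneg[of "x - fixpt i"]
        unfolding D_def by (simp del: abs2_nonneg)
      finally have "abs2 ((?g x - ?g (fixpt i)) - (fixpt i - y) / (2 * a)) \<le> 1 / B ^ 3"
        using start by (rule abs2_diff_le)
      moreover have "(?g x - ?g (fixpt i)) - (fixpt i - y) / (2 * a) = ?g x - fixpt i"
        by (simp add: f_fixpt)
      ultimately show "?g x \<in> D i" by (simp only: D_def mem_Collect_eq)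
    qed
    show "dist (?g x) (?g x') \<le> 1 / 2 * dist x x'" if "x \<in> D i" "x' \<in> D i" for x x'
      using contr that by (simp add: dist_q2_def)
  qed auto
  then obtain x where "x \<in> D i" "x - (f x - y) / (2 * a) = x" by blast
  then show ?thesis using a0 by auto
qed


section \<open>The Julia set\<close>

text \<open>Stated with \<open>f\<close> on the affine line. Such orbits avoid 0, so they agree with
  the orbits of \<open>phi a\<close>.\<close>

definition J :: "q2 set" where
  "J = {x. \<forall>n. abs2 ((f ^^ n) x) = 1 / B}"

lemma f_J:
  assumes "x \<in> J"
  shows "f x \<in> J"
proof -
  have "abs2 ((f ^^ Suc n) x) = 1 / B" for n using assms unfolding J_def by blast
  then show ?thesis by (simp add: J_def funpow_swap1)
qed

lemma funpow_f_J: "x \<in> J \<Longrightarrow> (f ^^ n) x \<in> J"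
  by (induction n) (auto intro: f_J)

lemma abs2_J: "x \<in> J \<Longrightarrow> abs2 x = 1 / B"
  unfolding J_def by (auto dest: spec[of _ 0])

lemma J_cases: "x \<in> J \<Longrightarrow> x \<in> D 0 \<or> x \<in> D 1"
  using sphere_cases abs2_J f_J by blast

lemma J_nonzero: "x \<in> J \<Longrightarrow> x \<noteq> 0"
  using J_cases D_nonzero by blast

lemma funpow_phi_J:
  assumes "x \<in> J"
  shows "(phi a ^^ n) (Fin x) = Fin ((f ^^ n) x)"
  by (induction n) (auto simp: phi_Fin J_nonzero[OF funpow_f_J[OF assms]])

lemma J_eq: "Fin ` J =
  {Fin x | x. \<forall>n. \<exists>y. (phi a ^^ n) (Fin x) = Fin y \<and> abs2 y = 1 / sqrt (abs2 a)}"
proof -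
  have "x \<in> J \<longleftrightarrow> (\<forall>n. \<exists>y. (phi a ^^ n) (Fin x) = Fin y \<and> abs2 y = 1 / B)" (is "_ \<longleftrightarrow> ?R") for x
  proof
    assume x: "x \<in> J"
    then show ?R using abs2_J[OF funpow_f_J[OF x]] by (simp add: funpow_phi_J)
  next
    assume R: ?R
    have "(phi a ^^ n) (Fin x) = Fin ((f ^^ n) x)" for n
    proof (induction n)
      case (Suc n)
      have "abs2 ((f ^^ n) x) = 1 / B" using R[rule_format, of n] Suc by simp
      then have "(f ^^ n) x \<noteq> 0" using inverse_B by auto
      then show ?case using Suc by (simp add: phi_Fin)
    qed simp
    then show "x \<in> J" using R by (simp add: J_def)
  qed
  then show ?thesis unfolding sqrt_abs2_a by auto
qed

lemma not_J_near_Infty: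
  assumes "u \<notin> Fin ` J"
  obtains m where "dist ((phi a ^^ m) u) Infty < 1"
proof -
  have "\<exists>n. \<forall>y. (phi a ^^ n) u = Fin y \<longrightarrow> abs2 y \<noteq> 1 / sqrt (abs2 a)"
  proof (cases u)
    case (Fin x)
    then show ?thesis using assms unfolding J_eq by blast
  next
    case Infty
    then show ?thesis by (auto intro: exI[of _ 0])
  qed
  then obtain n where "\<And>y. (phi a ^^ n) u = Fin y \<Longrightarrow> abs2 y \<noteq> 1 / sqrt (abs2 a)" by blast
  then have "dist ((phi a ^^ Suc n) u) Infty < 1"
    using near_Infty_phi[OF a_gt_1, of "(phi a ^^ n) u"] by simp
  then show ?thesis by (rule that)
qed

text \<open>The distance at least doubles at each step inside a common ball, yet it stays
  bounded.\<close>

lemma orbits_together_imp_eq: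
  assumes "\<And>n. \<exists>i. (f ^^ n) x \<in> D i \<and> (f ^^ n) y \<in> D i"
  shows "x = y"
proof -
  have *: "2 ^ n * abs2 (x - y) \<le> abs2 ((f ^^ n) x - (f ^^ n) y)" for n
  proof (induction n)
    case (Suc n)
    obtain i where "(f ^^ n) x \<in> D i" "(f ^^ n) y \<in> D i" using assms by blast
    then have "abs2 ((f ^^ Suc n) x - (f ^^ Suc n) y) = B\<^sup>2 / 2 * abs2 ((f ^^ n) x - (f ^^ n) y)"
      by (simp add: f_expand)
    also have "\<dots> \<ge> 2 * (2 ^ n * abs2 (x - y))"
      using Suc four_le_B_square by (intro mult_mono) auto
    finally show ?case by simp
  qed simp
  have "2 ^ n * abs2 (x - y) \<le> 1" for n
  proof -
    obtain i where "(f ^^ n) x \<in> D i" "(f ^^ n) y \<in> D i" using assms by blast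
    then have "abs2 ((f ^^ n) x - (f ^^ n) y) \<le> 1 / B ^ 3" by (rule D_diff)
    then show ?thesis using radius_less inverse_B *[of n] by linarith
  qed
  moreover have "\<exists>n. 2 ^ n * abs2 (x - y) > 1" if "x \<noteq> y"
  proof -
    have pos: "abs2 (x - y) > 0" using that by (simp add: abs2_pos_iff)
    obtain n where "1 / abs2 (x - y) < 2 ^ n" using real_arch_pow[of 2] by auto
    then show ?thesis using pos by (auto simp: field_simps)
  qed
  ultimately show ?thesis by (meson not_le)
qed

text \<open>Equicontinuity at scale 1/B^3 would keep the orbit of a nearby point in the same ball as
  that of \<open>x\<close> forever, against expansion.\<close>

lemma J_not_fatou:
  assumes x: "x \<in> J"
  shows "Fin x \<notin> fatou_set (phi a)"
proof
  assume "Fin x \<in> fatou_set (phi a)"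
  then obtain U where U: "open U" "Fin x \<in> U"
      "equicontinuous_at U {phi a ^^ n | n. n \<ge> 1} (Fin x)"
    unfolding fatou_set_def equicontinuous_on_def by blast
  obtain d where d: "d > 0" "\<And>n v. n \<ge> 1 \<Longrightarrow> v \<in> U \<Longrightarrow> dist (Fin x) v < d \<Longrightarrow>
      dist ((phi a ^^ n) (Fin x)) ((phi a ^^ n) v) < 1 / B ^ 3"
    using U(3) radius_pos unfolding equicontinuous_at_def by blast
  obtain e where e: "e > 0" "\<And>v. dist v (Fin x) < e \<Longrightarrow> v \<in> U"
    using U(1,2) unfolding open_dist by blast
  have "0 < min d (min e (1 / B ^ 3))" using d(1) e(1) radius_pos by simp
  then obtain k where k: "(1 / 2) ^ k < min d (min e (1 / B ^ 3))"
    using real_arch_pow_inv[of _ "1/2"] by fastforce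
  \<comment> \<open>Powers of 2 supply points different from \<open>x\<close> and arbitrarily close
    to it.\<close>
  define y where "y = x + 2 ^ k"
  have xy: "abs2 (x - y) = (1 / 2) ^ k" by (simp add: y_def abs2_power abs2_2)
  have "x \<noteq> y" by (simp add: y_def)
  have "(phi a ^^ n) (Fin y) = Fin ((f ^^ n) y) \<and> (\<exists>i. (f ^^ n) x \<in> D i \<and> (f ^^ n) y \<in> D i)" for n
  proof (induction n)
    case 0
    then show ?case using J_cases[OF x] D_closed xy k by auto
  next
    case (Suc n)
    then obtain i where i: "(f ^^ n) x \<in> D i" "(f ^^ n) y \<in> D i" by blast
    have y': "(phi a ^^ Suc n) (Fin y) = Fin ((f ^^ Suc n) y)"
      using Suc D_nonzero[OF i(2)] by (simp add: phi_Fin)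
    have y_sphere: "abs2 y = 1 / B"
      using abs2_eq_of_close[of y x] xy k radius_less abs2_J[OF x]
      by (simp add: abs2_diff_commute)
    have "dist (Fin x) (Fin y) = (1 / 2) ^ k"
      using y_sphere abs2_J[OF x] inverse_B xy by (simp add: dist_Fin dist_q2_def)
    then have "dist ((phi a ^^ Suc n) (Fin x)) ((phi a ^^ Suc n) (Fin y)) < 1 / B ^ 3"
      using k by (intro d e) (auto simp: dist_commute)
    \<comment> \<open>Both images lie on the sphere, inside the unit disc, where the spherical and
      2-adic distances coincide.\<close>
    moreover have "dist ((phi a ^^ Suc n) (Fin x)) ((phi a ^^ Suc n) (Fin y)) =
        abs2 ((f ^^ Suc n) x - (f ^^ Suc n) y)"
      unfolding y' funpow_phi_J[OF x] using abs2_f_D[OF i(1)] abs2_f_D[OF i(2)] inverse_B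
      by (simp add: dist_Fin dist_q2_def)
    ultimately have "abs2 ((f ^^ Suc n) x - (f ^^ Suc n) y) \<le> 1 / B ^ 3" by simp
    then show ?case using y' J_cases[OF funpow_f_J[OF x, of "Suc n"]] D_closed by blast
  qed
  then have "x = y" by (intro orbits_together_imp_eq) blast
  then show False using \<open>x \<noteq> y\<close> by simp
qed

lemma julia_set_phi: "julia_set (phi a) = Fin ` J"
proof -
  have "u \<in> fatou_set (phi a)" if u: "u \<notin> Fin ` J" for u
  proof -
    obtain m where "dist ((phi a ^^ m) u) Infty < 1" by (rule not_J_near_Infty[OF u])
    then show ?thesis by (rule near_Infty_imp(1)[OF a_gt_1])
  qed
  then show ?thesis using J_not_fatou by (auto simp: julia_set_def)
qed

lemma fatou_tendsto_Infty:
  assumes "u \<in> fatou_set (phi a)"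
  shows "(\<lambda>n. (phi a ^^ n) u) \<longlonglongrightarrow> Infty"
proof -
  have "u \<notin> Fin ` J" using assms J_not_fatou by auto
  then obtain m where "dist ((phi a ^^ m) u) Infty < 1" by (rule not_J_near_Infty)
  then show ?thesis by (rule near_Infty_imp(2)[OF a_gt_1])
qed


section \<open>The conjugacy with the shift\<close>

definition branch :: "nat \<Rightarrow> q2 \<Rightarrow> q2" where
  "branch i y = (SOME x. x \<in> D i \<and> f x = y)"

lemma branch:
  assumes "abs2 y = 1 / B"
  shows "branch i y \<in> D i" "f (branch i y) = y"
proof -
  have "\<exists>x. x \<in> D i \<and> f x = y" using D_onto_sphere[OF assms] by blast
  then have "branch i y \<in> D i \<and> f (branch i y) = y" unfolding branch_def by (rule someI_ex)
  then show "branch i y \<in> D i" "f (branch i y) = y" by auto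
qed

lemma branch_contract:
  assumes "abs2 y = 1 / B" "abs2 z = 1 / B"
  shows "abs2 (branch i y - branch i z) \<le> abs2 (y - z) / 2"
proof -
  have "abs2 (y - z) = B\<^sup>2 / 2 * abs2 (branch i y - branch i z)"
    using f_expand[of "branch i y" i "branch i z"] assms by (simp add: branch)
  also have "\<dots> \<ge> 2 * abs2 (branch i y - branch i z)"
    using four_le_B_square by (intro mult_right_mono) auto
  finally show ?thesis by simp
qed

text \<open>Pulls \<open>fixpt 0\<close>, a point of the sphere on which all branches are inverses
  of \<open>f\<close>, back along the first \<open>n\<close> symbols.\<close>

primrec approx :: "nat \<Rightarrow> (nat \<Rightarrow> nat) \<Rightarrow> q2" where
  "approx 0 s = fixpt 0"
| "approx (Suc n) s = branch (s 0) (approx n (left_shift s))"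

lemma abs2_approx: "abs2 (approx n s) = 1 / B"
  by (induction n arbitrary: s) (auto simp: abs2_fixpt intro: abs2_D[OF branch(1)])

text \<open>Each shared symbol contributes a contraction by 1/2. The case \<open>s = t\<close> gives
  convergence, the case \<open>k = l\<close> continuity of \<open>code\<close>.\<close>

lemma approx_close:
  assumes "\<And>i. i < n \<Longrightarrow> s i = t i" "n \<le> k" "n \<le> l"
  shows "abs2 (approx k s - approx l t) \<le> (1 / 2) ^ n"
  using assms
proof (induction n arbitrary: s t k l)
  case 0
  then show ?case using inverse_B by (intro abs2_diff_le) (auto simp: abs2_approx)
next
  case (Suc n)
  obtain k' l' where kl: "k = Suc k'" "l = Suc l'" "n \<le> k'" "n \<le> l'"
    using Suc.prems(2,3) by (metis Suc_le_D Suc_le_mono)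
  have "abs2 (approx k s - approx l t) \<le>
      abs2 (approx k' (left_shift s) - approx l' (left_shift t)) / 2"
    using branch_contract[OF abs2_approx abs2_approx, of "s 0"] Suc.prems(1)[of 0] kl by simp
  also have "\<dots> \<le> (1 / 2) ^ n / 2"
    using kl Suc.prems(1) by (intro divide_right_mono Suc.IH) (auto simp: left_shift_def)
  finally show ?case by simp
qed

definition code :: "(nat \<Rightarrow> nat) \<Rightarrow> q2" where
  "code s = lim (\<lambda>n. approx n s)"

lemma approx_tendsto: "(\<lambda>n. approx n s) \<longlonglongrightarrow> code s"
proof -
  have "Cauchy (\<lambda>n. approx n s)"
  proof (rule metric_CauchyI)
    fix e :: real assume "e > 0"
    then obtain N where N: "(1 / 2) ^ N < e" using real_arch_pow_inv[of e "1/2"] by auto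
    have "dist (approx m s) (approx n s) < e" if "m \<ge> N" "n \<ge> N" for m n
      using approx_close[of N s s m n] that N by (simp add: dist_q2_def)
    then show "\<exists>M. \<forall>m\<ge>M. \<forall>n\<ge>M. dist (approx m s) (approx n s) < e" by blast
  qed
  then show ?thesis
    unfolding code_def using Cauchy_convergent convergent_LIMSEQ_iff by blast
qed

lemma code_close:
  assumes "\<And>i. i < n \<Longrightarrow> s i = t i"
  shows "dist (code s) (code t) \<le> (1 / 2) ^ n"
proof (rule LIMSEQ_le_const2)
  show "(\<lambda>k. dist (approx k s) (approx k t)) \<longlonglongrightarrow> dist (code s) (code t)"
    by (intro tendsto_dist approx_tendsto)
  show "\<exists>N. \<forall>k\<ge>N. dist (approx k s) (approx k t) \<le> (1 / 2) ^ n"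
    unfolding dist_q2_def using approx_close[of n s t] assms by blast
qed

lemma abs2_code: "abs2 (code s) = 1 / B"
proof -
  obtain n where "dist (approx n s) (code s) < 1 / B"
    using metric_LIMSEQ_D[OF approx_tendsto inverse_B(1)] by blast
  then show ?thesis
    using abs2_eq_of_close[of "code s" "approx n s"]
    by (simp add: dist_q2_def abs2_approx abs2_diff_commute)
qed

text \<open>Branches contract, hence are continuous on the sphere, so the recursion of
  \<open>approx\<close> passes to the limit.\<close>

lemma code_eq: "code s = branch (s 0) (code (left_shift s))"
proof (rule LIMSEQ_unique)
  show "(\<lambda>n. approx (Suc n) s) \<longlonglongrightarrow> code s"
    by (rule LIMSEQ_Suc[OF approx_tendsto[of s]])
  have lim: "(\<lambda>n. dist (approx n (left_shift s)) (code (left_shift s))) \<longlonglongrightarrow> 0"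
    by (rule iffD1[OF tendsto_dist_iff approx_tendsto])
  have "dist (approx (Suc n) s) (branch (s 0) (code (left_shift s))) \<le>
      dist (approx n (left_shift s)) (code (left_shift s))" for n
    using branch_contract[OF abs2_approx abs2_code, of "s 0" n "left_shift s" "left_shift s"]
      abs2_nonneg[of "approx n (left_shift s) - code (left_shift s)"]
    unfolding dist_q2_def approx.simps by linarith
  then show "(\<lambda>n. approx (Suc n) s) \<longlonglongrightarrow> branch (s 0) (code (left_shift s))"
    unfolding tendsto_dist_iff[of "\<lambda>n. approx (Suc n) s"]
    by (intro tendsto_sandwich[OF _ _ tendsto_const lim]) auto
qed

lemma code_in_D: "code s \<in> D (s 0)"
  by (subst code_eq) (rule branch(1)[OF abs2_code])

lemma f_code: "f (code s) = code (left_shift s)"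
  by (subst code_eq) (rule branch(2)[OF abs2_code])

lemma funpow_f_code: "(f ^^ n) (code s) = code (\<lambda>i. s (i + n))"
proof -
  have "(f ^^ n) (code s) = code ((left_shift ^^ n) s)" by (induction n) (auto simp: f_code)
  then show ?thesis by (simp add: funpow_left_shift)
qed

lemma code_in_J: "code s \<in> J"
  by (simp add: J_def funpow_f_code abs2_code)

section \<open>Itineraries as the inverse of the coding\<close>

definition itinerary :: "q2 \<Rightarrow> nat \<Rightarrow> nat" where
  "itinerary x n = (if (f ^^ n) x \<in> D 0 then 0 else 1)"

lemma itinerary_Sigma2: "itinerary x \<in> Sigma2"
  by (simp add: Sigma2_def itinerary_def)

lemma itinerary_code:
  assumes "s \<in> Sigma2"
  shows "itinerary (code s) = s"
proof
  fix n
  have "(f ^^ n) (code s) \<in> D (s n)"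
    using code_in_D[of "\<lambda>i. s (i + n)"] by (simp add: funpow_f_code)
  moreover have "s n = 0 \<or> s n = 1" using assms by (auto simp: Sigma2_def)
  ultimately show "itinerary (code s) n = s n"
    using D_disjoint by (auto simp: itinerary_def)
qed

text \<open>On \<open>J\<close>, being outside \<open>D 0\<close> means being in \<open>D 1\<close>,
  so equal symbols put both orbits in a common ball at every time.\<close>

lemma itinerary_inj:
  assumes x: "x \<in> J" and y: "y \<in> J" and eq: "itinerary x = itinerary y"
  shows "x = y"
proof (rule orbits_together_imp_eq)
  fix n
  have "(f ^^ n) x \<in> D 0 \<longleftrightarrow> (f ^^ n) y \<in> D 0"
    using fun_cong[OF eq, of n] by (simp add: itinerary_def split: if_splits)
  then show "\<exists>i. (f ^^ n) x \<in> D i \<and> (f ^^ n) y \<in> D i"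
    using J_cases[OF funpow_f_J[OF x, of n]] J_cases[OF funpow_f_J[OF y, of n]] by blast
qed

text \<open>A right inverse of an injective map is also a left inverse.\<close>

lemma code_itinerary: "x \<in> J \<Longrightarrow> code (itinerary x) = x"
  by (intro itinerary_inj code_in_J itinerary_code itinerary_Sigma2)

text \<open>Unlike the exact expansion, this cruder bound also covers points in different
  balls.\<close>

lemma f_lipschitz_J:
  assumes "x \<in> J" "y \<in> J"
  shows "abs2 (f x - f y) \<le> B\<^sup>2 * abs2 (x - y)"
proof -
  have nz: "x \<noteq> 0" "y \<noteq> 0" using assms J_nonzero by auto
  have "abs2 (a - 1 / (x * y)) \<le> B\<^sup>2"
    using assms by (intro abs2_diff_le)
      (auto simp: abs2_a abs2_divide abs2_mult abs2_J power2_eq_square)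
  then show ?thesis
    unfolding phi_fin_diff[OF nz] abs2_mult mult.commute[of "abs2 (x - y)"]
    by (intro mult_right_mono) auto
qed

text \<open>Each coordinate is locally constant on \<open>J\<close>: points close enough have
  \<open>n\<close>-th iterates within 1/B^3, hence in the same ball.\<close>

lemma continuous_itinerary: "continuous_on J itinerary"
proof (rule continuous_on_coordinatewise_then_product)
  fix n
  have lip: "abs2 ((f ^^ n) x - (f ^^ n) y) \<le> (B\<^sup>2) ^ n * abs2 (x - y)"
    if "x \<in> J" "y \<in> J" for x y
  proof (induction n)
    case (Suc n)
    have "abs2 ((f ^^ Suc n) x - (f ^^ Suc n) y) \<le> B\<^sup>2 * abs2 ((f ^^ n) x - (f ^^ n) y)"
      using f_lipschitz_J[OF funpow_f_J[OF that(1)] funpow_f_J[OF that(2)]] by simp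
    also have "\<dots> \<le> B\<^sup>2 * ((B\<^sup>2) ^ n * abs2 (x - y))" using Suc by (intro mult_left_mono) auto
    finally show ?case by (simp add: mult.assoc)
  qed simp
  define d where "d = 1 / B ^ 3 / (B\<^sup>2) ^ n"
  have Bn: "(B\<^sup>2) ^ n > 0" using b_nonzero by (simp add: abs2_pos_iff)
  then have d: "d > 0" using radius_pos by (simp add: d_def)
  have const: "itinerary y n = itinerary x n" if "x \<in> J" "y \<in> J" "dist y x < d" for x y
  proof -
    have "(B\<^sup>2) ^ n * abs2 (x - y) \<le> (B\<^sup>2) ^ n * d"
      using that Bn by (intro mult_left_mono) (auto simp: dist_q2_def abs2_diff_commute)
    also have "\<dots> = 1 / B ^ 3" using Bn by (simp add: d_def)
    finally have "abs2 ((f ^^ n) x - (f ^^ n) y) \<le> 1 / B ^ 3" using lip[OF that(1,2)] by simp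
    then have "(f ^^ n) x \<in> D 0 \<longleftrightarrow> (f ^^ n) y \<in> D 0"
      using D_closed by (metis abs2_diff_commute)
    then show ?thesis by (simp add: itinerary_def)
  qed
  show "continuous_on J (\<lambda>x. itinerary x n)"
    unfolding continuous_on_def
  proof (intro ballI tendsto_eventually)
    fix x assume "x \<in> J"
    then show "\<forall>\<^sub>F y in at x within J. itinerary y n = itinerary x n"
      unfolding eventually_at using d const by blast
  qed
qed

lemma continuous_code: "continuous_on A code"
  unfolding continuous_on_def
proof (intro ballI tendstoI)
  fix s :: "nat \<Rightarrow> nat" and e :: real assume "e > 0"
  then obtain n where n: "(1 / 2) ^ n < e" using real_arch_pow_inv[of e "1/2"] by auto
  \<comment> \<open>The cylinder fixing the first \<open>n\<close> symbols, open in the product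
    topology.\<close>
  let ?U = "\<Inter>i\<in>{..<n}. (\<lambda>t. t i) -` {s i}"
  have "open ?U"
    by (intro open_INT finite_lessThan ballI open_vimage continuous_on_product_coordinates
        open_discrete)
  moreover have "s \<in> ?U" by simp
  moreover have "dist (code t) (code s) < e" if "t \<in> ?U" for t
    using code_close[of n t s] that n by force
  ultimately show "\<forall>\<^sub>F t in at s within A. dist (code t) (code s) < e"
    unfolding eventually_at_topological by blast
qed

lemma homeomorphism_itinerary: "homeomorphism J Sigma2 itinerary code"
proof (rule homeomorphismI)
  show "continuous_on J itinerary" by (rule continuous_itinerary)
  show "continuous_on Sigma2 code" by (rule continuous_code)
qed (auto simp: itinerary_Sigma2 code_in_J code_itinerary itinerary_code)

lemma itinerary_f: "itinerary (f x) = left_shift (itinerary x)"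
  by (rule ext) (simp add: itinerary_def left_shift_def funpow_swap1)

lemma conjugate_shift: "topologically_conjugate (Fin ` J) (phi a) Sigma2 left_shift"
proof -
  \<comment> \<open>The value at \<open>Infty\<close> is a default; the image of \<open>J\<close>
    under \<open>Fin\<close> consists of finite points.\<close>
  define unFin where "unFin u = (case u of Fin x \<Rightarrow> x | Infty \<Rightarrow> 0)" for u
  have iso: "dist (Fin x) (Fin y) = dist x y" if "x \<in> J" "y \<in> J" for x y
    using that inverse_B by (simp add: dist_Fin abs2_J)
  have "homeomorphism (Fin ` J) J unFin Fin"
  proof (rule homeomorphismI)
    show "continuous_on (Fin ` J) unFin"
      unfolding continuous_on_iff using iso by (force simp: unFin_def)
    show "continuous_on J Fin"
      unfolding continuous_on_iff using iso by force
  qed (auto simp: unFin_def)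
  then have "homeomorphism (Fin ` J) Sigma2 (itinerary \<circ> unFin) (Fin \<circ> code)"
    using homeomorphism_itinerary by (rule homeomorphism_compose)
  moreover have phi: "phi a (Fin x) = Fin (f x)" if "x \<in> J" for x
    by (intro phi_Fin J_nonzero that)
  then have "\<forall>u\<in>Fin ` J. (itinerary \<circ> unFin) (phi a u) = left_shift ((itinerary \<circ> unFin) u)"
    by (auto simp: unFin_def itinerary_f)
  moreover have "phi a ` Fin ` J \<subseteq> Fin ` J" using phi f_J by auto
  moreover have "left_shift ` Sigma2 \<subseteq> Sigma2" by (auto simp: Sigma2_def left_shift_def)
  ultimately show ?thesis unfolding topologically_conjugate_def by blast
qed

end

section \<open>The nonsquare case and the conclusion\<close>

lemma near_Infty_of_nonsquare:
  assumes a: "abs2 a > 1" and nonsquare: "\<nexists>b. b\<^sup>2 = 1 - a"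
  obtains m where "dist ((phi a ^^ m) u) Infty < 1"
proof (cases "\<exists>x. u = Fin x \<and> abs2 x = 1 / sqrt (abs2 a)")
  case False
  then show ?thesis using that[of 1] near_Infty_phi[OF a, of u] by auto
next
  case True
  then obtain x where x: "u = Fin x" "abs2 x = 1 / sqrt (abs2 a)" by blast
  then have "x \<noteq> 0" using a by auto
  then have "phi a u = Fin (phi_fin a x)" by (simp add: x phi_Fin)
  \<comment> \<open>Two consecutive points on the sphere would make 1 - a a square, so the orbit
    leaves it after one step and is near infinity after two.\<close>
  moreover have "abs2 (phi_fin a x) \<noteq> 1 / sqrt (abs2 a)"
    using square_of_sphere_to_sphere[OF a x(2)] nonsquare by blast
  ultimately have "dist (phi a (phi a u)) Infty < 1" by (intro near_Infty_phi a) auto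
  then show ?thesis using that[of 2] by (simp add: numeral_2_eq_2)
qed

theorem theorem1p2:
  fixes a :: q2
  assumes "abs2 a > 1"
  shows
    "((\<nexists>b. b\<^sup>2 = 1 - a) \<longrightarrow>
        fatou_set (phi a) = UNIV \<and>
        (\<forall>x. (\<lambda>n. (phi a ^^ n) (Fin x)) \<longlonglongrightarrow> Infty)) \<and>
     ((\<exists>b. b\<^sup>2 = 1 - a) \<longrightarrow>
        julia_set (phi a) =
          {Fin x | x. \<forall>n. \<exists>y. (phi a ^^ n) (Fin x) = Fin y \<and> abs2 y = 1 / sqrt (abs2 a)} \<and>
        topologically_conjugate (julia_set (phi a)) (phi a) Sigma2 left_shift \<and>
        (\<forall>u \<in> fatou_set (phi a). (\<lambda>n. (phi a ^^ n) u) \<longlonglongrightarrow> Infty))"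
proof (rule conjI; rule impI)
  assume nonsquare: "\<nexists>b. b\<^sup>2 = 1 - a"
  show "fatou_set (phi a) = UNIV \<and> (\<forall>x. (\<lambda>n. (phi a ^^ n) (Fin x)) \<longlonglongrightarrow> Infty)"
  proof (intro conjI allI UNIV_eq_I[symmetric])
    fix u
    obtain m where "dist ((phi a ^^ m) u) Infty < 1"
      by (rule near_Infty_of_nonsquare[OF assms nonsquare])
    then show "u \<in> fatou_set (phi a)" by (rule near_Infty_imp(1)[OF assms])
  next
    fix x
    obtain m where "dist ((phi a ^^ m) (Fin x)) Infty < 1"
      by (rule near_Infty_of_nonsquare[OF assms nonsquare])
    then show "(\<lambda>n. (phi a ^^ n) (Fin x)) \<longlonglongrightarrow> Infty" by (rule near_Infty_imp(2)[OF assms])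
  qed
next
  assume "\<exists>b. b\<^sup>2 = 1 - a"
  then obtain b where "b\<^sup>2 = 1 - a" by blast
  then interpret square_parameter a b using assms by unfold_locales
  show "julia_set (phi a) =
          {Fin x | x. \<forall>n. \<exists>y. (phi a ^^ n) (Fin x) = Fin y \<and> abs2 y = 1 / sqrt (abs2 a)} \<and>
        topologically_conjugate (julia_set (phi a)) (phi a) Sigma2 left_shift \<and>
        (\<forall>u \<in> fatou_set (phi a). (\<lambda>n. (phi a ^^ n) u) \<longlonglongrightarrow> Infty)"
    unfolding julia_set_phi J_eq[symmetric] using conjugate_shift fatou_tendsto_Infty by blast
qed

end
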